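(* Let $(G,R)$ and $(H,S)$ be connected anchored graphs. If $U$ is a quantum isomorphism of anchored graphs from $(G,R)$ to $(H,S)$, then $\Gamma(U)$ is a quantum isomorphism of anchored graphs from $\Gamma(G,R)$ to $\Gamma(H,S)$.
   Context: All graphs are finite and simple; connected graphs are nonempty. $\mathrm{Adj}(G)$ is the adjacency matrix. Quantum isomorphism: a magic unitary with coefficients in a (nonzero) unital $C^*$-algebra $X$ is a matrix $U=(u_{ij})_{i\in I,j\in J}$ with $I,J$ finite, $u_{ij}=u_{ij}^2=u_{ij}^*\in X$, and $\sum_{k\in I}u_{kj}=1=\sum_{k\in J}u_{ik}$ for all $i,j$. A quantum isomorphism from $G$ to $H$ (same number of vertices) is a magic unitary $U$ indexed by $V(H)\times V(G)$ with $U\,\mathrm{Adj}(G)=\mathrm{Adj}(H)\,U$. Blocks: if $G$ has at least two vertices, a cut vertex of $G$ is a vertex $v$ such that $G\setminus\{v\}$ has strictly more connected components than $G$; for a graph on one vertex, its only vertex is by convention a cut vertex. A graph is 2-connected if it is connected and $G\setminus\{v\}$ is connected and nonempty for every vertex $v$. A block of $G$ is a maximal 2-connected subgraph, also identified with its vertex set. Anchored graphs: a connected anchored graph is a pair $(G,R)$ with $G$ connected and $R\subseteq V(G)$ either a singleton consisting of a cut vertex of $G$ or (the vertex set of) a block of $G$. An anchored graph is a pair $(G,R)$ with $R\subseteq V(G)$ such that $(G_i,R\cap V(G_i))$ is a connected anchored graph for every connected component $G_i$ of $G$. A quantum isomorphism of anchored graphs from $(G,R)$ to $(H,S)$ is a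 quantum isomorphism $U$ from $G$ to $H$ such that $u_{ax}=0$ if ($x\in R$ and $a\notin S$) or ($x\notin R$ and $a\in S$). The operation $\Gamma$ on graphs: for a graph $F$ and $v\in V(F)$, let $\rho_F(v)=\{v\}$ if $v$ is a cut vertex or an isolated vertex of $F$, and let $\rho_F(v)$ be the vertex set of the unique block of $F$ containing $v$ otherwise. For a connected graph $G$ on at least two vertices and a cut vertex $r$ of $G$, let $C_1,\dots,C_k$ be the vertex sets of the connected components of $G\setminus r$; $\mathrm{split}(G,r)$ is the disjoint union of the graphs $G_i=G[C_i\cup\{r\}]$, and $r_i$ denotes the copy of $r$ in $G_i$. If $G=K_1$, then $\mathrm{split}(G,r)=G$ (with $k=1$, $r_1=r$). For a connected anchored graph $(G,R)$: if $R=\{r\}$ consists of a cut vertex, $\Gamma(G,R)=(\mathrm{split}(G,r),\bigcup_{i=1}^k\rho_{\mathrm{split}(G,r)}(r_i))$; otherwise ($R$ a block), $\Gamma(G,R)=(G\setminus E(R),\bigcup_{r\in R}\rho_{G\setminus E(R)}(r))$, where $G\setminus E(R)$ is obtained from $G$ by deleting all edges with both ends in $R$ (keeping all vertices). $\Gamma(G,R)$ is an anchored graph. The operation $\Gamma$ on quantum isomorphisms: let $U$ be a quantum isomorphism of anchored graphs from $(G,R)$ to $(H,S)$ (connected anchored graphs). Then $R$ is a block of $G$ iff $S$ is a block of $H$. If $R$ is a block, $\Gamma(U)=U$. If $R=\{r\}$ and $S=\{s\}$ are cut vertices and $G$ has at least two vertices, then $U=\mathrm{Diag}(U_0,1)$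 with $U_0$ a quantum isomorphism from $G\setminus r$ to $H\setminus s$; these graphs have the same number $k$ of connected components, with vertex sets $C_1,\dots,C_k$ and $D_1,\dots,D_k$ respectively. Fix $w_j\in C_j$ for each $j$ and put $p_{ij}=\sum_{b\in D_i}u_{bw_j}$ (independent of the choice of $w_j\in C_j$), $P(U_0)=(p_{ij})_{1\le i,j\le k}$. Then $\Gamma(U)=\mathrm{Diag}(U_0,P(U_0))$, where the rows of $P(U_0)$ are indexed by the copies $s_1,\dots,s_k$ of $s$ in $\mathrm{split}(H,s)$ and its columns by the copies $r_1,\dots,r_k$ of $r$ in $\mathrm{split}(G,r)$. If $G=K_1$, $\Gamma(U)=U$. *)

theory Defs
  imports Complex_Main "Graph_Theory.Digraph_Component"
begin

section \<open>Unital C*-algebras\<close>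

text \<open>
  The complex scalar multiplication and the involution are the new operations. The superclass
  \<open>real_normed_algebra_1\<close> contributes \<open>0 \<noteq> 1\<close>, a submultiplicative norm and
  \<open>norm 1 = 1\<close>; the latter is no restriction, since it follows from the C*-identity in every
  nonzero unital C*-algebra.
\<close>

class unital_cstar_algebra = real_normed_algebra_1 + banach +
  fixes scaleC :: "complex \<Rightarrow> 'a \<Rightarrow> 'a"
    and star :: "'a \<Rightarrow> 'a"
  assumes scaleC_add_right: "scaleC c (x + y) = scaleC c x + scaleC c y"
    and scaleC_add_left: "scaleC (c + d) x = scaleC c x + scaleC d x"
    and scaleC_scaleC: "scaleC c (scaleC d x) = scaleC (c * d) x"
    and scaleC_one: "scaleC 1 x = x"
    and scaleR_scaleC: "scaleR t x = scaleC (complex_of_real t) x"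
    and mult_scaleC_left: "scaleC c x * y = scaleC c (x * y)"
    and mult_scaleC_right: "x * scaleC c y = scaleC c (x * y)"
    and norm_scaleC: "norm (scaleC c x) = cmod c * norm x"
    and star_star: "star (star x) = x"
    and star_add: "star (x + y) = star x + star y"
    and star_scaleC: "star (scaleC c x) = scaleC (cnj c) (star x)"
    and star_mult: "star (x * y) = star y * star x"
    and cstar_identity: "norm (star x * x) = (norm x)\<^sup>2"

instantiation complex :: unital_cstar_algebra
begin

definition scaleC_complex :: "complex \<Rightarrow> complex \<Rightarrow> complex" where
  "scaleC_complex = (*)"

definition star_complex :: "complex \<Rightarrow> complex" where
  "star_complex = cnj"

instance
  by standard
    (simp_all add: scaleC_complex_def star_complex_def algebra_simps norm_mult
      scaleR_conv_of_real power2_eq_square)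

end

section \<open>Quantum isomorphisms\<close>

text \<open>
  Finite simple graphs are the objects satisfying \<^const>\<open>graph\<close>: finite symmetric digraphs
  without loops or parallel arcs. A matrix with rows indexed by \<open>I\<close> and columns indexed by
  \<open>J\<close> is a binary function of which only the values on \<open>I \<times> J\<close> are relevant.
\<close>

definition magic_unitary ::
    "'i set \<Rightarrow> 'j set \<Rightarrow> ('i \<Rightarrow> 'j \<Rightarrow> 'x::unital_cstar_algebra) \<Rightarrow> bool" where
  "magic_unitary I J U \<longleftrightarrow>
     finite I \<and> finite J \<and>
     (\<forall>i\<in>I. \<forall>j\<in>J. U i j = (U i j)\<^sup>2 \<and> U i j = star (U i j)) \<and>
     (\<forall>j\<in>J. (\<Sum>k\<in>I. U k j) = 1) \<and>
     (\<forall>i\<in>I. (\<Sum>k\<in>J. U i k) = 1)"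

definition adj :: "('a, 'e) pre_digraph \<Rightarrow> 'a \<Rightarrow> 'a \<Rightarrow> 'x::zero_neq_one" where
  "adj G x y = of_bool ((x, y) \<in> arcs_ends G)"

definition quantum_iso ::
    "('a, 'e) pre_digraph \<Rightarrow> ('b, 'f) pre_digraph \<Rightarrow> ('b \<Rightarrow> 'a \<Rightarrow> 'x::unital_cstar_algebra) \<Rightarrow> bool" where
  "quantum_iso G H U \<longleftrightarrow>
     graph G \<and> graph H \<and> card (verts G) = card (verts H) \<and>
     magic_unitary (verts H) (verts G) U \<and>
     (\<forall>a\<in>verts H. \<forall>x\<in>verts G.
        (\<Sum>y\<in>verts G. U a y * adj G y x) = (\<Sum>b\<in>verts H. adj H a b * U b x))"

section \<open>Blocks and anchored graphs\<close>

text \<open>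
  In a symmetric digraph the strongly connected components are the connected components, so
  \<^const>\<open>pre_digraph.sccs_verts\<close> is the set of their vertex sets.
\<close>

abbreviation components :: "('a, 'e) pre_digraph \<Rightarrow> 'a set set" where
  "components G \<equiv> pre_digraph.sccs_verts G"

definition cut_vertex :: "('a, 'e) pre_digraph \<Rightarrow> 'a \<Rightarrow> bool" where
  "cut_vertex G v \<longleftrightarrow> v \<in> verts G \<and>
     (verts G = {v} \<or> card (components G) < card (components (pre_digraph.del_vert G v)))"

text \<open>
  \<^const>\<open>Digraph_Component.connected\<close> graphs are nonempty by definition.
\<close>

definition two_connected :: "('a, 'e) pre_digraph \<Rightarrow> bool" where
  "two_connected G \<longleftrightarrow> graph G \<and> Digraph_Component.connected G \<and>
     (\<forall>v\<in>verts G. Digraph_Component.connected (pre_digraph.del_vert G v))"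

definition is_block :: "('a, 'e) pre_digraph \<Rightarrow> 'a set \<Rightarrow> bool" where
  "is_block G R \<longleftrightarrow> (\<exists>B. pre_digraph.max_subgraph G two_connected B \<and> verts B = R)"

definition connected_anchored_graph :: "('a, 'e) pre_digraph \<Rightarrow> 'a set \<Rightarrow> bool" where
  "connected_anchored_graph G R \<longleftrightarrow> graph G \<and> Digraph_Component.connected G \<and>
     ((\<exists>r. R = {r} \<and> cut_vertex G r) \<or> is_block G R)"

definition anchored_graph :: "('a, 'e) pre_digraph \<Rightarrow> 'a set \<Rightarrow> bool" where
  "anchored_graph G R \<longleftrightarrow> graph G \<and> R \<subseteq> verts G \<and>
     (\<forall>C\<in>components G. connected_anchored_graph (induce_subgraph G C) (R \<inter> C))"

definition anchored_quantum_iso ::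
    "('a, 'e) pre_digraph \<times> 'a set \<Rightarrow> ('b, 'f) pre_digraph \<times> 'b set \<Rightarrow>
     ('b \<Rightarrow> 'a \<Rightarrow> 'x::unital_cstar_algebra) \<Rightarrow> bool" where
  "anchored_quantum_iso = (\<lambda>(G, R) (H, S) U.
     anchored_graph G R \<and> anchored_graph H S \<and> quantum_iso G H U \<and>
     (\<forall>a\<in>verts H. \<forall>x\<in>verts G.
        (x \<in> R \<and> a \<notin> S) \<or> (x \<notin> R \<and> a \<in> S) \<longrightarrow> U a x = 0))"

section \<open>The operation \<open>\<Gamma>\<close>\<close>

definition rho :: "('a, 'e) pre_digraph \<Rightarrow> 'a \<Rightarrow> 'a set" where
  "rho F v = (if cut_vertex F v \<or> (\<nexists>w. (v, w) \<in> arcs_ends F) then {v}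
              else (THE B. is_block F B \<and> v \<in> B))"

definition relabel :: "('a \<Rightarrow> 'b) \<Rightarrow> ('a, 'e) pre_digraph \<Rightarrow> 'b pair_pre_digraph" where
  "relabel f G = \<lparr>pverts = f ` verts G, parcs = map_prod f f ` arcs_ends G\<rparr>"

text \<open>
  The graphs \<open>\<Gamma>(G, R)\<close> live on the vertex type \<open>'a + 'a set\<close>: \<open>Inl x\<close> is the
  vertex \<open>x\<close> of \<open>G\<close>, and, if \<open>G\<close> is split at \<open>r\<close>, \<open>Inr C\<close> is the copy of
  \<open>r\<close> attached to the component \<open>C\<close> of \<open>G - r\<close>. With this labelling the disjoint union
  of the graphs \<open>G[C \<union> {r}]\<close> is a plain union of relabelled graphs.
\<close>

definition split_label :: "'a \<Rightarrow> 'a set \<Rightarrow> 'a \<Rightarrow> 'a + 'a set" where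
  "split_label r C x = (if x = r then Inr C else Inl x)"

definition split_graph :: "('a, 'e) pre_digraph \<Rightarrow> 'a \<Rightarrow> ('a + 'a set) pair_pre_digraph" where
  "split_graph G r =
     (if verts G = {r} then relabel Inl G
      else \<lparr>pverts = (\<Union>C\<in>components (pre_digraph.del_vert G r).
               pverts (relabel (split_label r C) (induce_subgraph G (C \<union> {r})))),
            parcs = (\<Union>C\<in>components (pre_digraph.del_vert G r).
               parcs (relabel (split_label r C) (induce_subgraph G (C \<union> {r}))))\<rparr>)"

definition split_copies :: "('a, 'e) pre_digraph \<Rightarrow> 'a \<Rightarrow> ('a + 'a set) set" where
  "split_copies G r =
     (if verts G = {r} then {Inl r} else Inr ` components (pre_digraph.del_vert G r))"

definition del_edges_within :: "('a, 'e) pre_digraph \<Rightarrow> 'a set \<Rightarrow> ('a, 'e) pre_digraph" where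
  "del_edges_within G R = G\<lparr>arcs := {e \<in> arcs G. \<not> (tail G e \<in> R \<and> head G e \<in> R)}\<rparr>"

definition Gamma_graph ::
    "('a, 'e) pre_digraph \<Rightarrow> 'a set \<Rightarrow>
     ('a + 'a set, ('a + 'a set) \<times> ('a + 'a set)) pre_digraph \<times> ('a + 'a set) set" where
  "Gamma_graph G R =
     (if \<exists>r. R = {r} \<and> cut_vertex G r
      then let r = the_elem R; F = with_proj (split_graph G r)
           in (F, \<Union>v\<in>split_copies G r. rho F v)
      else let F = del_edges_within G R
           in (with_proj (relabel Inl F), Inl ` (\<Union>r\<in>R. rho F r)))"

text \<open>
  One formula covers all cases, because \<open>\<Gamma>(U)\<close> is only read on the vertex sets of
  \<open>\<Gamma>(H, S)\<close> and \<open>\<Gamma>(G, R)\<close>. If the anchors are blocks or the graphs have one vertex,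
  all vertices have the form \<open>Inl x\<close> and the matrix is \<open>U\<close>. If \<open>G\<close> and \<open>H\<close> are
  split at \<open>r\<close> and \<open>s\<close>, then \<open>Inl r\<close> and \<open>Inl s\<close> are not vertices, the \<open>Inl\<close>-\<open>Inl\<close>
  part is \<open>U\<^sub>0\<close>, and the \<open>Inr\<close>-\<open>Inr\<close> part is \<open>P(U\<^sub>0)\<close>. The function \<open>w\<close> gives the
  chosen vertex of each component of \<open>G - r\<close>.
\<close>

fun Gamma_matrix ::
    "('a set \<Rightarrow> 'a) \<Rightarrow> ('b \<Rightarrow> 'a \<Rightarrow> 'x::unital_cstar_algebra) \<Rightarrow>
     'b + 'b set \<Rightarrow> 'a + 'a set \<Rightarrow> 'x" where
  "Gamma_matrix w U (Inl a) (Inl x) = U a x"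
| "Gamma_matrix w U (Inr D) (Inr C) = (\<Sum>b\<in>D. U b (w C))"
| "Gamma_matrix w U (Inl a) (Inr C) = 0"
| "Gamma_matrix w U (Inr D) (Inl x) = 0"

end

theory Submission
  imports Defs
begin

text \<open>
  A quantum isomorphism \<open>U\<close> satisfies \<open>u\<^sub>a\<^sub>x u\<^sub>b\<^sub>y = 0\<close> whenever the pairs \<open>(x, y)\<close> and \<open>(a, b)\<close> are told
  apart by two-dimensional Weisfeiler-Leman refinement. Numbers of walks, and numbers of walks up to
  the first visit of a vertex, are such invariants; together they decide whether \<open>w\<close> separates \<open>x\<close>
  from \<open>y\<close>. Hence \<open>U\<close> respects cut vertices and the relation of being separated by no third vertex,
  which determine \<open>\<rho>\<close>. So it is enough that \<open>\<Gamma>(U)\<close> is a quantum isomorphism matching the copies of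
  the cut vertex, respectively the vertices of the block, with each other, and that every component
  of \<open>\<Gamma>(G, R)\<close> contains exactly one of these.
\<close>

section \<open>Projections in unital C*-algebras\<close>

text \<open>The refinement calculus rests on orthogonality of distinct entries in a row or a column.
  For operators on a Hilbert space this follows from positivity; here it is derived from norms
  alone: the C*-identity bounds projections by 1, and the unit of a corner is an extreme point of
  its unit ball. Blocks are subgraphs, not relations between two vertices, so the refinement cannot
  see them directly. They are recovered as maximal sets of pairwise inseparable vertices, where
  inseparability refers to the whole graph. That such a set is 2-connected by itself comes from a
  shortest walk argument, formulated for arbitrary subrelations of the edge relation. The same
  argument shows that deleting the edges inside a block disconnects its vertices from each other,
  which puts exactly one of them into each component.\<close>

context unital_cstar_algebra
begin

lemma scaleC_zero_right: "scaleC c 0 = 0"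
  using scaleC_add_right[of c 0 0] by simp

lemma scaleC_zero_left: "scaleC 0 x = 0"
  using scaleC_add_left[of 0 0 x] by simp

lemma scaleC_sum_right: "scaleC c (\<Sum>i\<in>A. f i) = (\<Sum>i\<in>A. scaleC c (f i))"
  by (induction A rule: infinite_finite_induct) (simp_all add: scaleC_zero_right scaleC_add_right)

lemma scaleC_sum_left: "scaleC (\<Sum>i\<in>A. f i) x = (\<Sum>i\<in>A. scaleC (f i) x)"
  by (induction A rule: infinite_finite_induct) (simp_all add: scaleC_zero_left scaleC_add_left)

lemma star_zero: "star 0 = 0"
  using star_add[of 0 0] by simp

lemma star_one: "star 1 = 1"
  using star_mult[of 1 "star 1"] star_star by simp

lemma star_minus: "star (- x) = - star x"
  using star_add[of x "- x"] by (simp add: star_zero eq_neg_iff_add_eq_0 add.commute)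

lemma star_diff: "star (x - y) = star x - star y"
  using star_add[of x "- y"] by (simp add: star_minus)

lemma star_sum: "star (\<Sum>i\<in>A. f i) = (\<Sum>i\<in>A. star (f i))"
  by (induction A rule: infinite_finite_induct) (simp_all add: star_zero star_add)

lemma star_mult_self_eq_0D: "star x * x = 0 \<Longrightarrow> x = 0"
  using cstar_identity[of x] by simp

end

definition projection :: "'x::unital_cstar_algebra \<Rightarrow> bool" where
  "projection p \<longleftrightarrow> p * p = p \<and> star p = p"

lemma norm_projection_le:
  assumes "projection p" shows "norm p \<le> 1"
proof -
  have "norm p * norm p = norm p"
    using assms cstar_identity[of p] by (simp add: projection_def power2_eq_square)
  then show ?thesis by auto
qed

lemma projection_compl: "projection p \<Longrightarrow> projection (1 - p)"
  by (simp add: projection_def star_diff star_one algebra_simps)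

lemma mult_projections_eq_0_commute:
  assumes "projection p" "projection q" "p * q = 0" shows "q * p = 0"
  using assms star_mult[of p q] by (simp add: projection_def star_zero)

text \<open>In the corner with unit \<open>p\<close> the zeroth power of \<open>b\<close> is
  \<open>p\<close>, whence \<open>e\<close>. The exponent is a successor since the zeroth power of
  \<open>p + scaleC z b\<close>, taken in the whole algebra, is 1.\<close>

lemma corner_binomial:
  fixes b p :: "'x::unital_cstar_algebra"
  assumes p: "p * p = p" and bp: "b * p = b" and pb: "p * b = b"
  defines "e \<equiv> \<lambda>j. if j = 0 then p else b ^ j"
  shows "(p + scaleC z b) ^ Suc n = (\<Sum>j\<le>Suc n. scaleC (of_nat (Suc n choose j) * z ^ j) (e j))"
proof -
  define S where "S n = (\<Sum>j\<le>n. scaleC (of_nat (n choose j) * z ^ j) (e j))" for n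
  have ep: "e j * p = e j" for j
    unfolding e_def by (cases j) (auto simp: p bp mult.assoc power_Suc2 simp del: power_Suc)
  have eb: "e j * b = e (Suc j)" for j
    unfolding e_def by (cases j) (auto simp: pb power_Suc2 simp del: power_Suc)
  have step: "S n * (p + scaleC z b) = S (Suc n)" for n
  proof -
    have "S n = (\<Sum>j\<le>Suc n. scaleC (of_nat (n choose j) * z ^ j) (e j))"
      unfolding S_def by (simp add: scaleC_zero_left binomial_eq_0)
    also have "\<dots> = e 0 + (\<Sum>j\<le>n. scaleC (of_nat (n choose Suc j) * z ^ Suc j) (e (Suc j)))"
      by (subst sum.atMost_Suc_shift) (simp add: scaleC_one)
    finally have 1: "S n * p = \<dots>"
      by (simp add: distrib_right sum_distrib_right mult_scaleC_left ep)
    have 2: "S n * scaleC z b = (\<Sum>j\<le>n. scaleC (of_nat (n choose j) * z ^ Suc j) (e (Suc j)))"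
      unfolding S_def
      by (simp add: sum_distrib_right mult_scaleC_left mult_scaleC_right eb scaleC_scaleC scaleC_sum_right mult_ac)
    have "S (Suc n) = e 0 + (\<Sum>j\<le>n. scaleC (of_nat (Suc n choose Suc j) * z ^ Suc j) (e (Suc j)))"
      unfolding S_def by (subst sum.atMost_Suc_shift) (simp add: scaleC_one)
    then show ?thesis
      unfolding distrib_left 1 2
      by (simp add: sum.distrib scaleC_add_left distrib_right add.assoc add.commute
        del: power_Suc)
  qed
  have base: "p + scaleC z b = S (Suc 0)"
    by (simp add: S_def e_def scaleC_one)
  have "(p + scaleC z b) ^ Suc n = S (Suc n)"
  proof (induction n)
    case (Suc n)
    show ?case by (simp only: power_Suc2[of _ "Suc n"] Suc.IH step)
  qed (simp add: base)
  then show ?thesis by (simp add: S_def)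
qed

text \<open>The exponent \<open>N - 1\<close> stands for -1 modulo \<open>N\<close>, so that the
  filter picks out the linear term. The sum vanishes unless \<open>N\<close> divides
  \<open>N - 1 + j\<close>, and for \<open>j \<le> N\<close> and \<open>2 \<le> N\<close> this
  happens only at \<open>j = 1\<close>.\<close>

lemma sum_root_of_unity_filter:
  assumes "2 \<le> N" "j \<le> N"
  shows "(\<Sum>k<N. cis (2 * pi * real k / real N) ^ (N - 1 + j)) = (if j = 1 then of_nat N else 0)"
proof -
  define om where "om = cis (2 * pi / real N)"
  have omk: "cis (2 * pi * real k / real N) = om ^ k" for k
    by (simp add: om_def DeMoivre mult_ac)
  have N0: "N > 0" using assms by simp
  have inj: "k = 0" if "om ^ k = 1" "k < N" for k
    using bij_betw_roots_unity[OF N0] that N0 omk[of k] omk[of 0]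
    by (auto simp: bij_betw_def inj_on_def)
  have omN: "om ^ N = 1" using omk[of N] N0 by simp
  define q where "q = om ^ (N - 1 + j)"
  have qN: "q ^ N = 1"
    unfolding q_def by (metis omN power_mult mult.commute power_one)
  have sum: "(\<Sum>k<N. cis (2 * pi * real k / real N) ^ (N - 1 + j)) = (\<Sum>k<N. q ^ k)"
    unfolding omk q_def by (simp add: power_mult [symmetric] mult.commute)
  show ?thesis
  proof (cases "j = 1")
    case True
    then have "q = 1" using omN N0 by (simp add: q_def)
    with sum True show ?thesis by simp
  next
    case False
    have "q \<noteq> 1"
    proof
      assume q1: "q = 1"
      show False
      proof (cases j)
        case 0
        then show False using q1 inj[of "N - 1"] assms by (simp add: q_def)
      next
        case (Suc i)
        then have "N - 1 + j = N + i" using N0 by simp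
        then have "om ^ i = 1" using q1 omN by (simp add: q_def power_add)
        then show False using inj[of i] Suc False assms by simp
      qed
    qed
    then show ?thesis using sum False qN by (simp add: geometric_sum)
  qed
qed


text \<open>The square |Re z| + |Im z| <= 1 is spanned by 1, -1, i and -i, so by convexity these
  four points suffice. The real ones are assumed; at the imaginary ones the C*-identity leads to
  \<open>p + b * b\<close>, the average of the squares of \<open>p + b\<close> and
  \<open>p - b\<close>.\<close>

lemma norm_corner_add_scaleC_le:
  fixes b p :: "'x::unital_cstar_algebra"
  assumes p: "projection p" and pb: "p * b = b" "b * p = b" and b: "star b = b"
    and le: "norm (p + b) \<le> 1" "norm (p - b) \<le> 1" and z: "\<bar>Re z\<bar> + \<bar>Im z\<bar> \<le> 1"
  shows "norm (p + scaleC z b) \<le> 1"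
proof -
  have pp: "p * p = p" "star p = p" using p by (auto simp: projection_def)
  have "2 *\<^sub>R (p + b * b) = (p + b) * (p + b) + (p - b) * (p - b)"
    by (simp add: algebra_simps pp pb scaleR_2)
  moreover have "norm ((p + b) * (p + b)) \<le> 1 * 1" "norm ((p - b) * (p - b)) \<le> 1 * 1"
    using le by (intro order_trans[OF norm_mult_ineq] mult_mono; simp)+
  ultimately have "norm (2 *\<^sub>R (p + b * b)) \<le> 2"
    using norm_triangle_ineq[of "(p + b) * (p + b)" "(p - b) * (p - b)"] by simp
  then have sq: "norm (p + b * b) \<le> 1" by simp
  have imag: "norm (p + scaleC (complex_of_real y * \<i>) b) \<le> 1" if y: "y = 1 \<or> y = -1" for y
  proof -
    let ?x = "p + scaleC (complex_of_real y * \<i>) b"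
    have "star (p + scaleC w b) * (p + scaleC w b) = p + (scaleC (w + cnj w) b + scaleC (cnj w * w) (b * b))" for w
      by (simp add: star_add star_scaleC b pp distrib_left distrib_right mult_scaleC_left
          mult_scaleC_right pb scaleC_scaleC add.assoc scaleC_add_left scaleC_add_right mult_ac)
    \<comment> \<open>For imaginary \<open>w\<close> of modulus 1 the linear coefficient
      \<open>w + cnj w\<close> vanishes and \<open>cnj w * w\<close> is 1.\<close>
    from this[of "complex_of_real y * \<i>"] have "star ?x * ?x = p + b * b"
      using y by (auto simp: scaleC_zero_left scaleC_one)
    with sq cstar_identity[of ?x] have "(norm ?x)\<^sup>2 \<le> 1" by simp
    then show ?thesis by (simp add: power_le_one_iff)
  qed
  define r i where "r = (if Re z \<ge> 0 then p + b else p - b)"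
    and "i = (if Im z \<ge> 0 then p + scaleC \<i> b else p + scaleC (- \<i>) b)"
  have ri: "norm r \<le> 1" "norm i \<le> 1"
    using le imag[of 1] imag[of "-1"] by (auto simp: r_def i_def)
  have r: "\<bar>Re z\<bar> *\<^sub>R r = \<bar>Re z\<bar> *\<^sub>R p + scaleC (of_real (Re z)) b"
    by (auto simp: r_def scaleR_diff_right scaleR_add_right scaleR_scaleC[symmetric])
  have i: "\<bar>Im z\<bar> *\<^sub>R i = \<bar>Im z\<bar> *\<^sub>R p + scaleC (of_real (Im z) * \<i>) b"
    by (auto simp: i_def scaleR_add_right scaleR_scaleC[of _ "scaleC _ _"] scaleC_scaleC)
  have "scaleC (of_real (Re z)) b + scaleC (of_real (Im z) * \<i>) b = scaleC z b"
    unfolding scaleC_add_left[symmetric] by (rule arg_cong[of _ _ "\<lambda>z. scaleC z b"]) (simp add: complex_eq_iff)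
  then have eq: "p + scaleC z b = (1 - \<bar>Re z\<bar> - \<bar>Im z\<bar>) *\<^sub>R p + (\<bar>Re z\<bar> *\<^sub>R r + \<bar>Im z\<bar> *\<^sub>R i)"
    unfolding r i by (simp add: algebra_simps)
  have "norm (p + scaleC z b) \<le> (1 - \<bar>Re z\<bar> - \<bar>Im z\<bar>) * norm p + (\<bar>Re z\<bar> * norm r + \<bar>Im z\<bar> * norm i)"
    unfolding eq using z
    by (intro order_trans[OF norm_triangle_ineq] add_mono) (auto intro: order_trans[OF norm_triangle_ineq])
  also have "\<dots> \<le> (1 - \<bar>Re z\<bar> - \<bar>Im z\<bar>) * 1 + (\<bar>Re z\<bar> * 1 + \<bar>Im z\<bar> * 1)"
    using z ri norm_projection_le[OF p] by (intro add_mono mult_left_mono) auto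
  finally show ?thesis by simp
qed

text \<open>
  The unit of a C*-algebra (here of the corner \<open>p X p\<close>) is an extreme point of the unit ball.
  Averaging \<open>\<omega>\<inverse> (p + \<omega> b / 2)\<^sup>N\<close> over the \<open>N\<close>-th roots of unity \<open>\<omega>\<close> isolates the linear
  coefficient \<open>N b / 2\<close>, which is therefore bounded independently of \<open>N\<close>.
\<close>

lemma corner_unit_extreme:
  fixes b p :: "'x::unital_cstar_algebra"
  assumes p: "projection p" and pb: "p * b = b" "b * p = b" and b: "star b = b"
    and le: "norm (p + b) \<le> 1" "norm (p - b) \<le> 1"
  shows "b = 0"
proof (rule ccontr)
  assume "b \<noteq> 0"
  have bound: "real N * norm b \<le> 2" if N: "2 \<le> N" for N
  proof -
    define om where "om k = cis (2 * pi * real k / real N)" for k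
    \<comment> \<open>The factor 1/2 brings the unit circle into the square |Re| + |Im| <= 1, where
      the norm bound holds.\<close>
    define c where "c k = om k / 2" for k
    define e where "e j = (if j = 0 then p else b ^ j)" for j
    have om: "cmod (om k) = 1" for k by (simp add: om_def)
    have "\<bar>Re (c k)\<bar> + \<bar>Im (c k)\<bar> \<le> 1" for k
      using abs_Re_le_cmod[of "om k"] abs_Im_le_cmod[of "om k"] by (simp add: c_def om)
    then have x: "norm (p + scaleC (c k) b) \<le> 1" for k
      using norm_corner_add_scaleC_le[OF p pb b le] by blast
    obtain n where n: "N = Suc n" using N by (cases N) auto
    have "(\<Sum>k<N. scaleC (om k ^ (N - 1)) ((p + scaleC (c k) b) ^ N)) =
        (\<Sum>k<N. \<Sum>j\<le>N. scaleC (of_nat (N choose j) / 2 ^ j * om k ^ (N - 1 + j)) (e j))"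
    proof (rule sum.cong[OF refl])
      fix k
      have "(p + scaleC (c k) b) ^ N = (\<Sum>j\<le>N. scaleC (of_nat (N choose j) * c k ^ j) (e j))"
        using p pb corner_binomial[of p b "c k" n] unfolding n e_def by (simp only: projection_def)
      then show "scaleC (om k ^ (N - 1)) ((p + scaleC (c k) b) ^ N) =
          (\<Sum>j\<le>N. scaleC (of_nat (N choose j) / 2 ^ j * om k ^ (N - 1 + j)) (e j))"
        by (simp add: scaleC_sum_right scaleC_scaleC c_def power_divide power_add mult_ac)
    qed
    also have "\<dots> = (\<Sum>j\<le>N. scaleC (of_nat (N choose j) / 2 ^ j * (\<Sum>k<N. om k ^ (N - 1 + j))) (e j))"
      by (subst sum.swap) (simp add: sum_distrib_left scaleC_sum_left)
    also have "\<dots> = (\<Sum>j\<le>N. if j = 1 then scaleC (of_nat N / 2 * of_nat N) b else 0)"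
    proof (rule sum.cong[OF refl])
      fix j assume "j \<in> {..N}"
      then have "(\<Sum>k<N. om k ^ (N - 1 + j)) = (if j = 1 then of_nat N else 0)"
        unfolding om_def by (intro sum_root_of_unity_filter[OF N]) simp
      then show "scaleC (of_nat (N choose j) / 2 ^ j * (\<Sum>k<N. om k ^ (N - 1 + j))) (e j) =
          (if j = 1 then scaleC (of_nat N / 2 * of_nat N) b else 0)"
        by (simp only:) (simp add: scaleC_zero_left e_def)
    qed
    also have "\<dots> = scaleC (of_nat N / 2 * of_nat N) b"
      using N by (subst sum.delta) auto
    finally have eq: "(\<Sum>k<N. scaleC (om k ^ (N - 1)) ((p + scaleC (c k) b) ^ N)) =
        scaleC (of_nat N / 2 * of_nat N) b" .
    have "norm (scaleC (om k ^ (N - 1)) ((p + scaleC (c k) b) ^ N)) \<le> 1" for k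
      using x[of k] by (simp add: norm_scaleC norm_power om)
        (intro order_trans[OF norm_power_ineq] power_le_one, auto)
    then have "norm (scaleC (of_nat N / 2 * of_nat N) b) \<le> (\<Sum>k<N. 1)"
      unfolding eq[symmetric] by (intro sum_norm_le) simp
    then have "real N * (real N * norm b) \<le> real N * 2"
      by (simp add: norm_scaleC norm_mult norm_divide)
    then show ?thesis using N by (simp add: mult_le_cancel_left)
  qed
  obtain M where "2 / norm b < real M" using reals_Archimedean2 by blast
  with \<open>b \<noteq> 0\<close> bound[of "M + 2"] show False
    by (simp add: divide_less_eq ring_distribs) (use norm_ge_zero[of b] in linarith)
qed

text \<open>Compressing the sum by \<open>p = q j\<close> makes the elements
  \<open>r k = p * q k * p\<close> with \<open>k \<noteq> j\<close> add up to 0. In place of their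
  positivity, the bound 1 on the norm of each \<open>p - r k\<close> is used: averaging gives a
  multiple \<open>b\<close> of \<open>r i\<close> with \<open>p + b\<close> and \<open>p - b\<close>
  both in the unit ball, and \<open>p\<close> is extreme.\<close>

lemma projections_sum_one_orthogonal:
  fixes q :: "'i \<Rightarrow> 'x::unital_cstar_algebra"
  assumes fin: "finite I" and proj: "\<And>i. i \<in> I \<Longrightarrow> projection (q i)" and sum: "(\<Sum>i\<in>I. q i) = 1"
    and ij: "i \<in> I" "j \<in> I" "i \<noteq> j"
  shows "q i * q j = 0"
proof -
  define p where "p = q j"
  have p: "projection p" "p * p = p" "star p = p" using proj ij by (auto simp: p_def projection_def)
  define r where "r k = p * q k * p" for k
  define J where "J = I - {j}"
  have J: "finite J" "i \<in> J" "J \<subseteq> I" using ij fin by (auto simp: J_def)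
  have pr: "p * r k = r k" "r k * p = r k" for k
    using p(2) by (auto simp: r_def mult.assoc) (simp add: mult.assoc[symmetric])
  have sr: "star (r k) = r k" if "k \<in> I" for k
    using proj[OF that] p by (simp add: r_def star_mult projection_def mult.assoc)
  have "(\<Sum>k\<in>I. r k) = p"
    unfolding r_def using sum p(2) by (simp add: sum_distrib_left[symmetric] sum_distrib_right[symmetric])
  moreover have "(\<Sum>k\<in>I. r k) = p + (\<Sum>k\<in>J. r k)"
    unfolding J_def using ij fin p(2) by (subst sum.remove[of _ j]) (auto simp: r_def p_def)
  ultimately have zero: "(\<Sum>k\<in>J. r k) = 0" by simp
  have pmr: "norm (p - r k) \<le> 1" if "k \<in> I" for k
  proof -
    have "p - r k = p * (1 - q k) * p" by (simp add: r_def algebra_simps p)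
    moreover have "norm (p * (1 - q k) * p) \<le> 1 * 1 * 1"
      using norm_projection_le[OF p(1)] norm_projection_le[OF projection_compl[OF proj[OF that]]]
      by (intro order_trans[OF norm_mult_ineq] mult_mono) auto
    ultimately show ?thesis by simp
  qed
  have "r i = 0"
  proof (cases "J = {i}")
    case True
    then show ?thesis using zero by simp
  next
    case False
    define m where "m = card (J - {i})"
    have "J - {i} \<noteq> {}" using J False by blast
    then have m: "m \<ge> 1" using J card_gt_0_iff[of "J - {i}"] by (simp add: m_def Suc_le_eq)
    \<comment> \<open>Scaling by the number \<open>m\<close> of the other indices makes
      \<open>p + b\<close> the average of \<open>p - r k\<close> over them, while
      \<open>p - b\<close> lies on the segment from \<open>p\<close> to
      \<open>p - r i\<close>.\<close>
    define b where "b = (1 / real m) *\<^sub>R r i"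
    have "r i + (\<Sum>k\<in>J - {i}. r k) = 0"
      using zero sum.remove[OF J(1,2), of r] by simp
    then have "(\<Sum>k\<in>J - {i}. r k) = - r i" by (simp only: add_eq_0_iff)
    then have "(\<Sum>k\<in>J - {i}. p - r k) = real m *\<^sub>R p + r i"
      by (simp add: sum_subtractf sum_constant_scaleR m_def del: sum_constant)
    also have "\<dots> = real m *\<^sub>R (p + b)" using m by (simp add: b_def scaleR_add_right)
    finally have eq: "(\<Sum>k\<in>J - {i}. p - r k) = real m *\<^sub>R (p + b)" .
    have "norm (real m *\<^sub>R (p + b)) \<le> (\<Sum>k\<in>J - {i}. 1)"
      unfolding eq[symmetric] using pmr J by (intro sum_norm_le) auto
    then have le1: "norm (p + b) \<le> 1" using m by (simp add: m_def)
    have "p - b = (1 - 1 / real m) *\<^sub>R p + (1 / real m) *\<^sub>R (p - r i)"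
      by (simp add: b_def scaleR_diff_left scaleR_diff_right)
    also have "norm \<dots> \<le> (1 - 1 / real m) * 1 + (1 / real m) * 1"
      using m norm_projection_le[OF p(1)] pmr[OF ij(1)]
      by (intro order_trans[OF norm_triangle_ineq] add_mono) (auto intro!: mult_left_le simp: divide_simps)
    finally have le2: "norm (p - b) \<le> 1" by simp
    have "b = 0"
      using sr[OF ij(1)] star_scaleC[of "of_real (1 / real m)" "r i"]
      by (intro corner_unit_extreme[OF p(1) _ _ _ le1 le2]) (simp_all add: b_def pr scaleR_scaleC mult_scaleC_left mult_scaleC_right)
    then show ?thesis using m by (simp add: b_def)
  qed
  \<comment> \<open>This product is \<open>r i\<close>, so the C*-identity undoes the
    compression.\<close>
  then have "star (q i * p) * (q i * p) = 0"
    using proj[OF ij(1)] p by (simp add: r_def star_mult projection_def mult.assoc)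
      (simp add: mult.assoc[symmetric])
  then show ?thesis using star_mult_self_eq_0D p_def by blast
qed

section \<open>Relations respected by a magic unitary\<close>

locale magic =
  fixes I :: "'i set" and J :: "'j set" and U :: "'i \<Rightarrow> 'j \<Rightarrow> 'x::unital_cstar_algebra"
  assumes magic_unitary: "magic_unitary I J U"
begin

lemma finite_rows: "finite I" and finite_cols: "finite J"
  using magic_unitary by (auto simp: magic_unitary_def)

lemma sum_col: "x \<in> J \<Longrightarrow> (\<Sum>a\<in>I. U a x) = 1"
  and sum_row: "a \<in> I \<Longrightarrow> (\<Sum>x\<in>J. U a x) = 1"
  using magic_unitary by (auto simp: magic_unitary_def)

lemma projection_entry: "a \<in> I \<Longrightarrow> x \<in> J \<Longrightarrow> projection (U a x)"
  using magic_unitary by (auto simp: magic_unitary_def projection_def power2_eq_square)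

lemma row_orthogonal:
  assumes "a \<in> I" "x \<in> J" "y \<in> J" "x \<noteq> y" shows "U a x * U a y = 0"
  using projections_sum_one_orthogonal[OF finite_cols _ sum_row] projection_entry assms by blast

lemma col_orthogonal:
  assumes "a \<in> I" "b \<in> I" "x \<in> J" "a \<noteq> b" shows "U a x * U b x = 0"
  using projections_sum_one_orthogonal[OF finite_rows _ sum_col, where j = b] projection_entry assms
  by blast

lemma entry_idem: "a \<in> I \<Longrightarrow> x \<in> J \<Longrightarrow> U a x * U a x = U a x"
  using projection_entry by (auto simp: projection_def)

text \<open>Double counting of the entries in rows \<open>S\<close> and columns \<open>R\<close>: by
  columns they add up to \<open>card R\<close> times 1, by rows to \<open>card S\<close> times
  1.\<close>

lemma card_blocks_eq:
  assumes "R \<subseteq> J" "S \<subseteq> I" "\<And>a x. a \<in> I \<Longrightarrow> x \<in> J \<Longrightarrow> U a x \<noteq> 0 \<Longrightarrow> x \<in> R \<longleftrightarrow> a \<in> S"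
  shows "card R = card S"
proof -
  have "(\<Sum>a\<in>S. U a x) = 1" if "x \<in> R" for x
    using that assms sum_col[of x] finite_rows
    by (subst sum.mono_neutral_left[of I S]) auto
  moreover have "(\<Sum>x\<in>R. U a x) = 1" if "a \<in> S" for a
    using that assms sum_row[of a] finite_cols
    by (subst sum.mono_neutral_left[of J R]) auto
  ultimately have "(of_nat (card R) :: 'x) = of_nat (card S)"
    using sum.swap[of "\<lambda>a x. U a x" R S] by simp
  then show ?thesis by simp
qed

lemma card_eq: "card I = card J"
  using card_blocks_eq[of J I] by simp

text \<open>The invariants carried by \<open>U\<close> are colours of pairs. Entries in different
  rows and columns need not commute, so only a nonzero product links two pairs. Colours have any
  type: truth values give relations, functions on \<open>nat\<close> bundle infinitely many counts
  into one colour.\<close>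

definition compat :: "('j \<Rightarrow> 'j \<Rightarrow> 'v) \<Rightarrow> ('i \<Rightarrow> 'i \<Rightarrow> 'v) \<Rightarrow> bool" where
  "compat X Y \<longleftrightarrow>
     (\<forall>a\<in>I. \<forall>b\<in>I. \<forall>x\<in>J. \<forall>y\<in>J. U a x * U b y \<noteq> 0 \<longrightarrow> X x y = Y a b)"

lemma compatD:
  "compat X Y \<Longrightarrow> a \<in> I \<Longrightarrow> b \<in> I \<Longrightarrow> x \<in> J \<Longrightarrow> y \<in> J \<Longrightarrow> U a x * U b y \<noteq> 0 \<Longrightarrow> X x y = Y a b"
  by (auto simp: compat_def)

text \<open>Orthogonality within rows and columns in disguise; it supplies the initial colour of the
  refinement.\<close>

lemma compat_eq: "compat (=) (=)"
  unfolding compat_def using row_orthogonal col_orthogonal by metis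

lemma compat_const: "compat (\<lambda>x y. c) (\<lambda>a b. c)"
  by (simp add: compat_def)

lemma compat_map: "compat X Y \<Longrightarrow> compat (\<lambda>x y. f (X x y)) (\<lambda>a b. f (Y a b))"
  by (simp add: compat_def)

lemma compat_map2:
  "compat X Y \<Longrightarrow> compat X' Y' \<Longrightarrow>
    compat (\<lambda>x y. f (X x y) (X' x y)) (\<lambda>a b. f (Y a b) (Y' a b))"
  by (simp add: compat_def)

lemma compat_fun: "(\<And>n. compat (X n) (Y n)) \<Longrightarrow> compat (\<lambda>x y n. X n x y) (\<lambda>a b n. Y n a b)"
  by (simp add: compat_def)

text \<open>Taking adjoints reverses a product of two projections, so whether it vanishes does not
  depend on the order.\<close>

lemma compat_transpose: "compat X Y \<Longrightarrow> compat (\<lambda>x y. X y x) (\<lambda>a b. Y b a)"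
  unfolding compat_def using mult_projections_eq_0_commute projection_entry by metis

text \<open>
  This is the refinement step of the two-dimensional Weisfeiler-Leman algorithm: inserting
  \<open>1 = (\<Sum>c. U c z)\<close> or \<open>1 = (\<Sum>z. U c z)\<close> between two entries compares the two sums termwise.
\<close>

lemma compat_sum:
  fixes f :: "'p \<Rightarrow> 'q \<Rightarrow> 'r \<Rightarrow> nat"
  assumes "compat X1 Y1" "compat X2 Y2" "compat X3 Y3"
  shows "compat (\<lambda>x y. \<Sum>z\<in>J. f (X1 x z) (X2 z y) (X3 x y)) (\<lambda>a b. \<Sum>c\<in>I. f (Y1 a c) (Y2 c b) (Y3 a b))"
  unfolding compat_def
proof (intro ballI impI)
  fix a b x y assume ab: "a \<in> I" "b \<in> I" and xy: "x \<in> J" "y \<in> J" and ne: "U a x * U b y \<noteq> 0"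
  \<comment> \<open>The outer pair is fixed, so its colour is a constant shared by both
    sums.\<close>
  define t where "t = Y3 a b"
  have t: "X3 x y = t" using compatD[OF assms(3)] ab xy ne by (auto simp: t_def)
  let ?F = "\<lambda>z. f (X1 x z) (X2 z y) t" and ?G = "\<lambda>c. f (Y1 a c) (Y2 c b) t"
  have F: "real (?F z) *\<^sub>R (U a x * U b y) = (\<Sum>c\<in>I. real (?F z) *\<^sub>R (U a x * U c z * U b y))"
    if "z \<in> J" for z
  proof -
    have "U a x * U b y = U a x * (\<Sum>c\<in>I. U c z) * U b y" using sum_col[OF that] by simp
    also have "\<dots> = (\<Sum>c\<in>I. U a x * U c z * U b y)" by (simp add: sum_distrib_left sum_distrib_right)
    finally show ?thesis by (simp add: scaleR_sum_right)
  qed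
  have G: "real (?G c) *\<^sub>R (U a x * U b y) = (\<Sum>z\<in>J. real (?G c) *\<^sub>R (U a x * U c z * U b y))"
    if "c \<in> I" for c
  proof -
    have "U a x * U b y = U a x * (\<Sum>z\<in>J. U c z) * U b y" using sum_row[OF that] by simp
    also have "\<dots> = (\<Sum>z\<in>J. U a x * U c z * U b y)" by (simp add: sum_distrib_left sum_distrib_right)
    finally show ?thesis by (simp add: scaleR_sum_right)
  qed
  \<comment> \<open>If an adjacent pair of factors has product 0, both sides vanish; otherwise both
    colours entering the weight agree.\<close>
  have FG: "real (?F z) *\<^sub>R (U a x * U c z * U b y) = real (?G c) *\<^sub>R (U a x * U c z * U b y)"
    if "z \<in> J" "c \<in> I" for z c
  proof (cases "U a x * U c z = 0 \<or> U c z * U b y = 0")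
    case True
    then have "U a x * U c z * U b y = 0" by (metis mult.assoc mult_zero_left mult_zero_right)
    then show ?thesis by simp
  next
    case False
    then show ?thesis using that ab xy compatD[OF assms(1)] compatD[OF assms(2)] by metis
  qed
  have "real (\<Sum>z\<in>J. ?F z) *\<^sub>R (U a x * U b y) = (\<Sum>z\<in>J. \<Sum>c\<in>I. real (?F z) *\<^sub>R (U a x * U c z * U b y))"
    by (simp add: scaleR_sum_left F)
  also have "\<dots> = (\<Sum>c\<in>I. \<Sum>z\<in>J. real (?G c) *\<^sub>R (U a x * U c z * U b y))"
    by (subst sum.swap) (simp add: FG)
  also have "\<dots> = real (\<Sum>c\<in>I. ?G c) *\<^sub>R (U a x * U b y)"
    by (simp add: scaleR_sum_left G)
  finally have "(\<Sum>z\<in>J. ?F z) = (\<Sum>c\<in>I. ?G c)"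
    using ne by (metis of_nat_eq_iff scaleR_cancel_right)
  then show "(\<Sum>z\<in>J. f (X1 x z) (X2 z y) (X3 x y)) = (\<Sum>c\<in>I. f (Y1 a c) (Y2 c b) (Y3 a b))"
    by (simp add: t t_def)
qed

text \<open>Existence over a finite set is a nonzero count of witnesses, hence the refinement step
  with indicator weights.\<close>

lemma compat_Bex:
  assumes "compat X1 Y1" "compat X2 Y2" "compat X3 Y3"
  shows "compat (\<lambda>x y. \<exists>z\<in>J. P (X1 x z) (X2 z y) (X3 x y)) (\<lambda>a b. \<exists>c\<in>I. P (Y1 a c) (Y2 c b) (Y3 a b))"
proof -
  have "(\<exists>z\<in>J. Q z) \<longleftrightarrow> (\<Sum>z\<in>J. of_bool (Q z)) \<noteq> (0::nat)"
    "(\<exists>c\<in>I. R c) \<longleftrightarrow> (\<Sum>c\<in>I. of_bool (R c)) \<noteq> (0::nat)" for Q R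
    using finite_rows finite_cols by auto
  then show ?thesis
    by (simp only:) (rule compat_map[OF compat_sum[OF assms, where f = "\<lambda>p q r. of_bool (P p q r)"]])
qed

text \<open>Multiplying the equation at \<open>(a, y)\<close> by \<open>U a x\<close> on the left
  and \<open>U b y\<close> on the right leaves one summand on each side, by orthogonality.
  Backwards, inserting column and row sums equal to 1 expands both sides into the same
  products.\<close>

lemma intertwines_iff_compat:
  fixes P :: "'j \<Rightarrow> 'j \<Rightarrow> bool" and Q :: "'i \<Rightarrow> 'i \<Rightarrow> bool"
  shows "(\<forall>a\<in>I. \<forall>x\<in>J. (\<Sum>y\<in>J. U a y * of_bool (P y x)) = (\<Sum>b\<in>I. of_bool (Q a b) * U b x)) \<longleftrightarrow>
    compat P Q"
proof (intro iffI ballI)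
  assume eq: "\<forall>a\<in>I. \<forall>x\<in>J. (\<Sum>y\<in>J. U a y * of_bool (P y x)) = (\<Sum>b\<in>I. of_bool (Q a b) * U b x)"
  show "compat P Q"
    unfolding compat_def
  proof (intro ballI impI)
    fix a b x y assume ab: "a \<in> I" "b \<in> I" and xy: "x \<in> J" "y \<in> J" and ne: "U a x * U b y \<noteq> 0"
    have "(\<Sum>z\<in>J. U a x * (U a z * of_bool (P z y)) * U b y) = U a x * of_bool (P x y) * U b y"
      using ab xy finite_cols row_orthogonal[OF ab(1) xy(1)] entry_idem
      by (subst sum.remove[of J x]) (fastforce simp: mult.assoc[symmetric] intro!: sum.neutral)+
    moreover have "(\<Sum>c\<in>I. U a x * (of_bool (Q a c) * U c y) * U b y) = U a x * of_bool (Q a b) * U b y"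
      using ab xy finite_rows col_orthogonal entry_idem
      by (subst sum.remove[of I b]) (auto simp: mult.assoc intro!: sum.neutral)
    moreover have "U a x * (\<Sum>z\<in>J. U a z * of_bool (P z y)) * U b y =
        U a x * (\<Sum>c\<in>I. of_bool (Q a c) * U c y) * U b y"
      using eq ab xy by simp
    ultimately have "U a x * of_bool (P x y) * U b y = U a x * of_bool (Q a b) * U b y"
      by (simp only: sum_distrib_left sum_distrib_right)
    then show "P x y = Q a b" using ne by (auto split: if_splits simp: of_bool_def)
  qed
next
  fix a x assume r: "compat P Q" and ax: "a \<in> I" "x \<in> J"
  have "(\<Sum>y\<in>J. U a y * of_bool (P y x)) = (\<Sum>y\<in>J. \<Sum>b\<in>I. U a y * U b x * of_bool (P y x))"
    using ax by (simp add: sum_distrib_left[symmetric] sum_distrib_right[symmetric] sum_col)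
  also have "\<dots> = (\<Sum>y\<in>J. \<Sum>b\<in>I. U a y * U b x * of_bool (Q a b))"
    using r ax by (intro sum.cong refl) (metis mult_zero_left compatD)
  also have "\<dots> = (\<Sum>b\<in>I. \<Sum>y\<in>J. U a y * (U b x * of_bool (Q a b)))"
    by (subst sum.swap) (simp add: mult.assoc)
  also have "\<dots> = (\<Sum>b\<in>I. of_bool (Q a b) * U b x)"
    using ax by (intro sum.cong refl) (simp add: sum_distrib_right[symmetric] sum_row of_bool_def)
  finally show "(\<Sum>y\<in>J. U a y * of_bool (P y x)) = (\<Sum>b\<in>I. of_bool (Q a b) * U b x)" .
qed

end

lemma quantum_iso_iff:
  "quantum_iso G H U \<longleftrightarrow> graph G \<and> graph H \<and> magic_unitary (verts H) (verts G) U \<and>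
     magic.compat (verts H) (verts G) U
       (\<lambda>x y. (x, y) \<in> arcs_ends G) (\<lambda>a b. (a, b) \<in> arcs_ends H)"
proof (cases "magic_unitary (verts H) (verts G) U")
  case True
  then interpret magic "verts H" "verts G" U by unfold_locales
  show ?thesis
    using True card_eq intertwines_iff_compat[of "\<lambda>x y. (x, y) \<in> arcs_ends G" "\<lambda>a b. (a, b) \<in> arcs_ends H"]
    by (auto simp: quantum_iso_def adj_def)
qed (simp add: quantum_iso_def)

section \<open>Walks and separating vertices\<close>

text \<open>Here \<open>w\<close> stays behind as an isolated point, so that no vertex set has to be
  carried along; \<open>separating\<close> and \<open>inseparable\<close> exclude it as an
  endpoint.\<close>

definition remove_vertex :: "'a rel \<Rightarrow> 'a \<Rightarrow> 'a rel" where
  "remove_vertex E w = {(x, y) \<in> E. x \<noteq> w \<and> y \<noteq> w}"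

definition separating :: "'a rel \<Rightarrow> 'a \<Rightarrow> bool" where
  "separating E v \<longleftrightarrow> (\<exists>x y. x \<noteq> v \<and> y \<noteq> v \<and> (x, y) \<in> E\<^sup>* \<and> (x, y) \<notin> (remove_vertex E v)\<^sup>*)"

text \<open>For distinct vertices of a finite graph this means lying in a common block, expressed as
  a property of a pair so that it can serve as a colour.\<close>

definition inseparable :: "'a rel \<Rightarrow> 'a \<Rightarrow> 'a \<Rightarrow> bool" where
  "inseparable E x y \<longleftrightarrow> (x, y) \<in> E\<^sup>* \<and> (\<forall>w. w \<noteq> x \<longrightarrow> w \<noteq> y \<longrightarrow> (x, y) \<in> (remove_vertex E w)\<^sup>*)"

primrec walks :: "'a set \<Rightarrow> 'a rel \<Rightarrow> nat \<Rightarrow> 'a \<Rightarrow> 'a \<Rightarrow> nat" where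
  "walks V E 0 x y = of_bool (x = y)"
| "walks V E (Suc n) x y = (\<Sum>z\<in>V. of_bool ((x, z) \<in> E) * walks V E n z y)"

text \<open>The value 0 at \<open>x = w\<close> for positive lengths makes the final visit to
  \<open>w\<close> the first one.\<close>

primrec first_walks :: "'a set \<Rightarrow> 'a rel \<Rightarrow> nat \<Rightarrow> 'a \<Rightarrow> 'a \<Rightarrow> nat" where
  "first_walks V E 0 x w = of_bool (x = w)"
| "first_walks V E (Suc n) x w = (if x = w then 0 else \<Sum>z\<in>V. of_bool ((x, z) \<in> E) * first_walks V E n z w)"

lemma walks_neq_0_iff:
  assumes "finite V" "E \<subseteq> V \<times> V"
  shows "walks V E n x y \<noteq> 0 \<longleftrightarrow> (x, y) \<in> E ^^ n"
proof (induction n arbitrary: x)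
  case (Suc n)
  have "(x, y) \<in> E ^^ Suc n \<longleftrightarrow> (\<exists>z\<in>V. (x, z) \<in> E \<and> (z, y) \<in> E ^^ n)"
    using assms(2) relpow_Suc_I2[of x _ E y n] relpow_Suc_D2[of x y n E] by blast
  then show ?case using assms Suc.IH by auto
qed auto

lemma ex_walk_iff:
  assumes "finite V" "E \<subseteq> V \<times> V"
  shows "(\<exists>n. walks V E n x y \<noteq> 0) \<longleftrightarrow> (x, y) \<in> E\<^sup>*"
  by (simp only: walks_neq_0_iff[OF assms] rtrancl_power)

text \<open>A walk either avoids \<open>w\<close> or factors uniquely at its first visit to
  \<open>w\<close>. The avoiding term is set to 0 for \<open>x = w\<close>, since the empty walk at
  the isolated point \<open>w\<close> would otherwise be counted twice.\<close>

lemma walks_decompose: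
  "walks V E n x y = (if x = w then 0 else walks V (remove_vertex E w) n x y) +
     (\<Sum>j\<le>n. first_walks V E j x w * walks V E (n - j) w y)"
proof (induction n arbitrary: x)
  case (Suc n)
  show ?case
  proof (cases "x = w")
    case True
    then show ?thesis by (subst sum.atMost_Suc_shift) simp
  next
    case False
    let ?A = "\<lambda>z. of_bool ((x, z) \<in> E) :: nat"
    have "walks V E (Suc n) x y = (\<Sum>z\<in>V. ?A z * (if z = w then 0 else walks V (remove_vertex E w) n z y)) +
        (\<Sum>z\<in>V. \<Sum>j\<le>n. ?A z * first_walks V E j z w * walks V E (n - j) w y)"
      by (subst walks.simps, subst Suc.IH)
        (simp only: distrib_left sum.distrib sum_distrib_left mult.assoc)
    also have "(\<Sum>z\<in>V. ?A z * (if z = w then 0 else walks V (remove_vertex E w) n z y)) =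
        walks V (remove_vertex E w) (Suc n) x y"
      using False by (auto simp: remove_vertex_def intro!: sum.cong)
    also have "(\<Sum>z\<in>V. \<Sum>j\<le>n. ?A z * first_walks V E j z w * walks V E (n - j) w y) =
        (\<Sum>j\<le>n. first_walks V E (Suc j) x w * walks V E (n - j) w y)"
      using False by (subst sum.swap) (simp add: sum_distrib_right)
    also have "\<dots> = (\<Sum>j\<le>Suc n. first_walks V E j x w * walks V E (Suc n - j) w y)"
      using False by (subst sum.atMost_Suc_shift) simp
    finally show ?thesis using False by simp
  qed
qed simp

text \<open>
  Whether \<open>w\<close> separates \<open>x\<close> from \<open>y\<close> depends only on data attached to the pairs \<open>(x, y)\<close>,
  \<open>(x, w)\<close> and \<open>(w, y)\<close>: compare all walks from \<open>x\<close> to \<open>y\<close> with those decomposed at their first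
  visit to \<open>w\<close>.
\<close>

definition detour :: "(nat \<Rightarrow> nat) \<Rightarrow> (nat \<Rightarrow> nat) \<Rightarrow> (nat \<Rightarrow> nat) \<Rightarrow> bool" where
  "detour p q r \<longleftrightarrow> (\<exists>n. p n \<noteq> (\<Sum>j\<le>n. q j * r (n - j)))"

lemma remove_vertex_subset: "E \<subseteq> V \<times> V \<Longrightarrow> remove_vertex E w \<subseteq> V \<times> V"
  by (auto simp: remove_vertex_def)

lemma detour_iff:
  assumes "finite V" "E \<subseteq> V \<times> V" "x \<noteq> w"
  shows "detour (\<lambda>n. walks V E n x y) (\<lambda>n. first_walks V E n x w) (\<lambda>n. walks V E n w y) \<longleftrightarrow>
    (x, y) \<in> (remove_vertex E w)\<^sup>*"
proof -
  have "walks V E n x y \<noteq> (\<Sum>j\<le>n. first_walks V E j x w * walks V E (n - j) w y) \<longleftrightarrow>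
      walks V (remove_vertex E w) n x y \<noteq> 0" for n
    using walks_decompose[of V E n x y w] assms(3) by simp
  then show ?thesis
    unfolding detour_def using ex_walk_iff[OF assms(1) remove_vertex_subset[OF assms(2)]] by simp
qed

lemma remove_vertex_outside: "E \<subseteq> V \<times> V \<Longrightarrow> w \<notin> V \<Longrightarrow> remove_vertex E w = E"
  by (auto simp: remove_vertex_def)

lemma rtrancl_in: "(x, y) \<in> E\<^sup>* \<Longrightarrow> E \<subseteq> V \<times> V \<Longrightarrow> x = y \<or> x \<in> V \<and> y \<in> V"
  by (induction rule: rtrancl_induct) auto

text \<open>Removing a point outside \<open>V\<close> changes nothing, so the quantifier can be
  bounded; what remains depends on the colours of \<open>(x, w)\<close>, \<open>(w, y)\<close> and
  \<open>(x, y)\<close>, the format of \<open>compat_Bex\<close>.\<close>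

lemma inseparable_alt:
  assumes "finite V" "E \<subseteq> V \<times> V"
  shows "inseparable E x y \<longleftrightarrow> (x, y) \<in> E\<^sup>* \<and> \<not> (\<exists>w\<in>V. x \<noteq> w \<and> w \<noteq> y \<and>
    \<not> detour (\<lambda>n. walks V E n x y) (\<lambda>n. first_walks V E n x w) (\<lambda>n. walks V E n w y))"
  unfolding inseparable_def using detour_iff[OF assms] remove_vertex_outside[OF assms(2)] by metis

text \<open>With nested quantifiers each one is a refinement step: the inner one yields a colour of
  the pair \<open>(x, v)\<close>, the outer one a colour depending on \<open>v\<close>
  alone.\<close>

lemma separating_alt:
  assumes "finite V" "E \<subseteq> V \<times> V"
  shows "separating E v \<longleftrightarrow> (\<exists>x\<in>V. x \<noteq> v \<and> (\<exists>y\<in>V. y \<noteq> v \<and> (x, y) \<in> E\<^sup>* \<and>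
    \<not> detour (\<lambda>n. walks V E n x y) (\<lambda>n. first_walks V E n x v) (\<lambda>n. walks V E n v y)))"
proof
  assume "separating E v"
  then obtain x y where xy: "x \<noteq> v" "y \<noteq> v" "(x, y) \<in> E\<^sup>*" "(x, y) \<notin> (remove_vertex E v)\<^sup>*"
    by (auto simp: separating_def)
  then have "x \<noteq> y" by auto
  with rtrancl_in[OF xy(3) assms(2)] have "x \<in> V" "y \<in> V" by auto
  with xy detour_iff[OF assms] show "\<exists>x\<in>V. x \<noteq> v \<and> (\<exists>y\<in>V. y \<noteq> v \<and> (x, y) \<in> E\<^sup>* \<and>
    \<not> detour (\<lambda>n. walks V E n x y) (\<lambda>n. first_walks V E n x v) (\<lambda>n. walks V E n v y))" by blast
next
  assume "\<exists>x\<in>V. x \<noteq> v \<and> (\<exists>y\<in>V. y \<noteq> v \<and> (x, y) \<in> E\<^sup>* \<and>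
    \<not> detour (\<lambda>n. walks V E n x y) (\<lambda>n. first_walks V E n x v) (\<lambda>n. walks V E n v y))"
  then show "separating E v" unfolding separating_def using detour_iff[OF assms] by blast
qed

section \<open>Colours of vertex pairs respected by a quantum isomorphism\<close>

locale magic_graph = magic +
  fixes E :: "'b rel" and F :: "'a rel"
  assumes E: "E \<subseteq> J \<times> J" and F: "F \<subseteq> I \<times> I"
    and compat_edge: "compat (\<lambda>x y. (x, y) \<in> E) (\<lambda>a b. (a, b) \<in> F)"
begin

lemma compat_walks: "compat (walks J E n) (walks I F n)"
proof (induction n)
  case 0
  show ?case using compat_map[OF compat_eq, of of_bool] by simp
next
  case (Suc n)
  show ?case
    using compat_sum[OF compat_edge Suc compat_const, of "\<lambda>p q r. of_bool p * q"] by simp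
qed

lemma compat_first_walks: "compat (first_walks J E n) (first_walks I F n)"
proof (induction n)
  case 0
  show ?case using compat_map[OF compat_eq, of of_bool] by simp
next
  case (Suc n)
  show ?case
    using compat_map2[OF compat_eq compat_sum[OF compat_edge Suc compat_const, of "\<lambda>p q r. of_bool p * q"],
        of "\<lambda>p k. if p then 0 else k"] by simp
qed

lemma compat_walk_counts: "compat (\<lambda>x y n. walks J E n x y) (\<lambda>a b n. walks I F n a b)"
  by (rule compat_fun) (rule compat_walks)

lemma compat_first_walk_counts:
  "compat (\<lambda>x y n. first_walks J E n x y) (\<lambda>a b n. first_walks I F n a b)"
  by (rule compat_fun) (rule compat_first_walks)

lemma compat_reachable: "compat (\<lambda>x y. (x, y) \<in> E\<^sup>*) (\<lambda>a b. (a, b) \<in> F\<^sup>*)"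
  using compat_map[OF compat_walk_counts, of "\<lambda>p. \<exists>n. p n \<noteq> 0"]
  by (simp only: ex_walk_iff[OF finite_cols E] ex_walk_iff[OF finite_rows F])

lemma compat_inseparable: "compat (inseparable E) (inseparable F)"
proof -
  let ?P = "\<lambda>(e, q) (e', r) p. \<not> e \<and> \<not> e' \<and> \<not> detour p q r"
  have "compat (\<lambda>x y. \<exists>w\<in>J. ?P (x = w, \<lambda>n. first_walks J E n x w) (w = y, \<lambda>n. walks J E n w y) (\<lambda>n. walks J E n x y))
      (\<lambda>a b. \<exists>w\<in>I. ?P (a = w, \<lambda>n. first_walks I F n a w) (w = b, \<lambda>n. walks I F n w b) (\<lambda>n. walks I F n a b))"
    by (rule compat_Bex[OF compat_map2[OF compat_eq compat_first_walk_counts]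
          compat_map2[OF compat_eq compat_walk_counts] compat_walk_counts])
  from compat_map2[OF compat_reachable this, of "\<lambda>p q. p \<and> \<not> q"]
  show ?thesis
    using inseparable_alt[OF finite_cols E] inseparable_alt[OF finite_rows F]
    by (simp add: compat_def)
qed

lemma compat_separating: "compat (\<lambda>x y. separating E x) (\<lambda>a b. separating F a)"
proof -
  let ?P = "\<lambda>(t, p) (e, r) q. \<not> e \<and> t \<and> \<not> detour p q r"
  \<comment> \<open>The bound vertex \<open>y\<close> takes the middle position, so the colour of
    \<open>(y, v)\<close> has to contain the counts of walks from \<open>v\<close> to
    \<open>y\<close>; hence the transposition.\<close>
  have "compat (\<lambda>x v. \<exists>y\<in>J. ?P ((x, y) \<in> E\<^sup>*, \<lambda>n. walks J E n x y) (y = v, \<lambda>n. walks J E n v y) (\<lambda>n. first_walks J E n x v))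
      (\<lambda>x v. \<exists>y\<in>I. ?P ((x, y) \<in> F\<^sup>*, \<lambda>n. walks I F n x y) (y = v, \<lambda>n. walks I F n v y) (\<lambda>n. first_walks I F n x v))"
    (is "compat ?K ?L")
    by (rule compat_Bex[OF compat_map2[OF compat_reachable compat_walk_counts]
          compat_map2[OF compat_eq compat_transpose[OF compat_walk_counts]] compat_first_walk_counts])
  from compat_transpose[OF compat_map2[OF compat_eq this, of "\<lambda>p q. \<not> p \<and> q"]]
  have "compat (\<lambda>v x. x \<noteq> v \<and> ?K x v) (\<lambda>v x. x \<noteq> v \<and> ?L x v)" .
  \<comment> \<open>Constant colours in the other two places leave a colour of the first vertex
    alone.\<close>
  from compat_Bex[OF this compat_const compat_const, of "\<lambda>p q r. p"]
  show ?thesis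
    using separating_alt[OF finite_cols E] separating_alt[OF finite_rows F]
    by (simp add: compat_def)
qed

end

section \<open>Blocks as maximal inseparable sets\<close>

lemma sym_remove_vertex: "sym E \<Longrightarrow> sym (remove_vertex E w)"
  by (auto simp: sym_def remove_vertex_def)

lemma sym_rtranclD: "sym E \<Longrightarrow> (x, y) \<in> E\<^sup>* \<Longrightarrow> (y, x) \<in> E\<^sup>*"
  by (meson sym_rtrancl symD)

lemma rtrancl_remove_vertex_subset: "(x, y) \<in> (remove_vertex E w)\<^sup>* \<Longrightarrow> (x, y) \<in> E\<^sup>*"
  using rtrancl_mono[of "remove_vertex E w" E] by (auto simp: remove_vertex_def)

lemma inseparable_refl: "inseparable E x x"
  by (simp add: inseparable_def)

lemma inseparable_sym: "sym E \<Longrightarrow> inseparable E x y \<Longrightarrow> inseparable E y x"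
  unfolding inseparable_def by (meson sym_remove_vertex sym_rtranclD)

lemma inseparable_remove_vertex:
  "inseparable E x y \<Longrightarrow> w \<noteq> x \<Longrightarrow> w \<noteq> y \<Longrightarrow> (x, y) \<in> (remove_vertex E w)\<^sup>*"
  by (simp add: inseparable_def)

lemma inseparable_reachable: "inseparable E x y \<Longrightarrow> (x, y) \<in> E\<^sup>*"
  by (simp add: inseparable_def)

lemma inseparable_edge: "(x, y) \<in> E \<Longrightarrow> inseparable E x y"
  by (auto simp: inseparable_def remove_vertex_def)

text \<open>The counterpart of a block for edge relations. Two distinct elements are demanded
  because a 2-connected graph has at least two vertices.\<close>

definition maximal_inseparable :: "'a rel \<Rightarrow> 'a set \<Rightarrow> bool" where
  "maximal_inseparable E K \<longleftrightarrow> (\<exists>x\<in>K. \<exists>y\<in>K. x \<noteq> y) \<and> (\<forall>x\<in>K. \<forall>y\<in>K. inseparable E x y) \<and>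
     (\<forall>z. (\<forall>x\<in>K. inseparable E x z) \<longrightarrow> z \<in> K)"

text \<open>If the walk meets \<open>x\<close>, its tail from there is a walk from \<open>x\<close>
  to \<open>y\<close> that is no longer. For the remainder of a shortest walk from \<open>x\<close>
  to \<open>y\<close> this second alternative is impossible.\<close>

lemma relpow_avoids_or_meets:
  "(z, y) \<in> R ^^ m \<Longrightarrow> (z, y) \<in> (remove_vertex R x)\<^sup>* \<or> (\<exists>j\<le>m. (x, y) \<in> R ^^ j)"
proof (induction m arbitrary: z)
  case (Suc m)
  obtain z' where z': "(z, z') \<in> R" "(z', y) \<in> R ^^ m"
    using relpow_Suc_D2[OF Suc.prems] by blast
  show ?case
  proof (cases "\<exists>j\<le>Suc m. (x, y) \<in> R ^^ j")
    case False
    then have "z \<noteq> x" "z' \<noteq> x" using Suc.prems z'(2) le_SucI by blast+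
    then have "(z, z') \<in> remove_vertex R x" using z'(1) by (simp add: remove_vertex_def)
    moreover have "(z', y) \<in> (remove_vertex R x)\<^sup>*" using Suc.IH[OF z'(2)] False le_SucI by blast
    ultimately show ?thesis by (meson converse_rtrancl_into_rtrancl)
  qed simp
qed simp

text \<open>
  A shortest walk between two vertices of a maximal inseparable set \<open>K\<close> cannot leave \<open>K\<close>: its
  second vertex is inseparable from all of \<open>K\<close>, since a shortest walk does not return to its start.
\<close>

lemma maximal_inseparable_convex:
  assumes "sym E" and K: "maximal_inseparable E K" and "R \<subseteq> E"
    and "x \<in> K" "y \<in> K" "(x, y) \<in> R\<^sup>*"
  shows "(x, y) \<in> (R \<inter> K \<times> K)\<^sup>*"
proof -
  have insep: "inseparable E x y" if "x \<in> K" "y \<in> K" for x y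
    using K that unfolding maximal_inseparable_def by blast
  have "(x, y) \<in> (R \<inter> K \<times> K)\<^sup>*" if "(x, y) \<in> R ^^ n" "x \<in> K" for n x
    using that
  proof (induction n arbitrary: x rule: less_induct)
    case (less n)
    show ?case
    proof (cases "\<exists>m<n. (x, y) \<in> R ^^ m")
      case True
      then show ?thesis using less by blast
    next
      case minimal: False
      show ?thesis
      proof (cases n)
        case 0
        then show ?thesis using less by simp
      next
        case (Suc m)
        then obtain z where z: "(x, z) \<in> R" "(z, y) \<in> R ^^ m"
          using relpow_Suc_D2[of x y m R] less.prems(1) by blast
        have xz: "(x, z) \<in> E" using z \<open>R \<subseteq> E\<close> by blast
        have "x \<noteq> y" using minimal Suc by auto
        have avoid: "(z, y) \<in> (remove_vertex E x)\<^sup>*"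
        proof -
          have "(z, y) \<in> (remove_vertex R x)\<^sup>*"
            using relpow_avoids_or_meets[OF z(2), of x] minimal Suc by (auto simp: less_Suc_eq_le)
          then show ?thesis
            using \<open>R \<subseteq> E\<close> rtrancl_mono[of "remove_vertex R x" "remove_vertex E x"]
            by (auto simp: remove_vertex_def)
        qed
        have "inseparable E k z" if k: "k \<in> K" for k
          unfolding inseparable_def
        proof (intro conjI allI impI)
          show "(k, z) \<in> E\<^sup>*"
            using inseparable_reachable[OF insep[OF k less.prems(2)]] xz by (meson rtrancl.rtrancl_into_rtrancl)
          fix w assume w: "w \<noteq> k" "w \<noteq> z"
          show "(k, z) \<in> (remove_vertex E w)\<^sup>*"
          \<comment> \<open>If \<open>x\<close> is removed, the route from \<open>k\<close> to
            \<open>z\<close> goes via \<open>y\<close> and back along the shortest walk; otherwise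
            it goes via \<open>x\<close> and the edge to \<open>z\<close>.\<close>
          proof (cases "w = x")
            case True
            then have "(k, y) \<in> (remove_vertex E x)\<^sup>*"
              using inseparable_remove_vertex[OF insep[OF k \<open>y \<in> K\<close>]] w \<open>x \<noteq> y\<close> by blast
            moreover have "(y, z) \<in> (remove_vertex E x)\<^sup>*"
              by (rule sym_rtranclD[OF sym_remove_vertex[OF \<open>sym E\<close>] avoid])
            ultimately show ?thesis using True by (simp add: rtrancl_trans)
          next
            case False
            then have "(k, x) \<in> (remove_vertex E w)\<^sup>*"
              using inseparable_remove_vertex[OF insep[OF k less.prems(2)]] w by blast
            moreover have "(x, z) \<in> remove_vertex E w" using xz w False by (simp add: remove_vertex_def)
            ultimately show ?thesis by (rule rtrancl.rtrancl_into_rtrancl)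
          qed
        qed
        then have "z \<in> K" using K unfolding maximal_inseparable_def by blast
        have "m < n" using Suc by simp
        from less.IH[OF this z(2) \<open>z \<in> K\<close>] have "(z, y) \<in> (R \<inter> K \<times> K)\<^sup>*" .
        moreover have "(x, z) \<in> R \<inter> K \<times> K" using z(1) \<open>z \<in> K\<close> less.prems(2) by simp
        ultimately show ?thesis by (rule converse_rtrancl_into_rtrancl[rotated])
      qed
    qed
  qed
  then show ?thesis using assms rtrancl_imp_relpow by metis
qed

text \<open>Inseparability is not transitive, as two blocks may share a cut vertex. So a set maximal
  under inclusion is taken among the candidates, of which there are finitely many because two
  distinct elements force them into \<open>V\<close>.\<close>

lemma inseparable_set_extend:
  assumes "finite V" "E \<subseteq> V \<times> V" and "\<exists>x\<in>K. \<exists>y\<in>K. x \<noteq> y" and "\<forall>x\<in>K. \<forall>y\<in>K. inseparable E x y"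
    and "sym E"
  obtains K' where "K \<subseteq> K'" "maximal_inseparable E K'"
proof -
  define P where "P L \<longleftrightarrow> K \<subseteq> L \<and> (\<forall>x\<in>L. \<forall>y\<in>L. inseparable E x y)" for L
  have PV: "L \<subseteq> V" if "P L" for L
  proof
    fix x assume "x \<in> L"
    obtain k l where "k \<in> K" "l \<in> K" "k \<noteq> l" using assms(3) by blast
    moreover have "K \<subseteq> L" using \<open>P L\<close> by (simp add: P_def)
    ultimately obtain y where "y \<in> L" "x \<noteq> y" by (metis subsetD)
    then have "(x, y) \<in> E\<^sup>*" using \<open>P L\<close> \<open>x \<in> L\<close> by (simp add: P_def inseparable_def)
    then show "x \<in> V" using rtrancl_in[OF _ assms(2)] \<open>x \<noteq> y\<close> by blast
  qed
  have "finite (Collect P)" using PV assms(1) by (intro finite_subset[of "Collect P" "Pow V"]) auto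
  moreover have "P K" using assms by (simp add: P_def)
  ultimately obtain K' where "K' \<in> Collect P" and max: "\<forall>L\<in>Collect P. K' \<subseteq> L \<longrightarrow> K' = L"
    using finite_has_maximal2[of "Collect P" K] by blast
  then have "P K'" by simp
  then have K': "K \<subseteq> K'" "\<And>x y. x \<in> K' \<Longrightarrow> y \<in> K' \<Longrightarrow> inseparable E x y"
    unfolding P_def by blast+
  have "z \<in> K'" if z: "\<And>x. x \<in> K' \<Longrightarrow> inseparable E x z" for z
  proof -
    have "inseparable E x y" if "x \<in> insert z K'" "y \<in> insert z K'" for x y
      using that K'(2)[of x y] z[of x] inseparable_sym[OF \<open>sym E\<close> z[of y]] inseparable_refl[of E z]
      by (elim insertE) simp_all
    then have "P (insert z K')" using K'(1) by (auto simp: P_def)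
    then show ?thesis using max by blast
  qed
  moreover have "\<exists>x\<in>K'. \<exists>y\<in>K'. x \<noteq> y" using K'(1) assms(3) by blast
  ultimately have "maximal_inseparable E K'"
    using K'(2) unfolding maximal_inseparable_def by blast
  then show ?thesis using K'(1) that by blast
qed

text \<open>The vertex set of \<open>\<rho>\<^sub>F(v)\<close>, read off from the edge relation of \<open>F\<close>.\<close>

definition anchor :: "'a rel \<Rightarrow> 'a \<Rightarrow> 'a set" where
  "anchor E v = {x. x = v \<or> \<not> separating E v \<and> inseparable E v x}"

text \<open>Two vertices inseparable from \<open>v\<close> stay joined through \<open>v\<close> when
  another vertex is removed, and removing \<open>v\<close> does no harm because it does not
  separate. So the vertices inseparable from \<open>v\<close> form a clique, the only block at
  \<open>v\<close>.\<close>

lemma maximal_inseparable_anchor: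
  assumes "sym E" "\<not> separating E v" "(v, u) \<in> E" "u \<noteq> v"
  shows "maximal_inseparable E (anchor E v)"
    and "maximal_inseparable E K \<Longrightarrow> v \<in> K \<Longrightarrow> K = anchor E v"
proof -
  have anchor: "anchor E v = {x. inseparable E v x}"
    using assms(2) inseparable_refl[of E v] by (auto simp: anchor_def)
  have clique: "inseparable E x y" if "inseparable E v x" "inseparable E v y" for x y
    unfolding inseparable_def
  proof (intro conjI allI impI)
    have vx: "inseparable E x v" using inseparable_sym[OF assms(1) that(1)] .
    show r: "(x, y) \<in> E\<^sup>*"
      using vx that(2) by (meson inseparable_reachable rtrancl_trans)
    fix w assume w: "w \<noteq> x" "w \<noteq> y"
    show "(x, y) \<in> (remove_vertex E w)\<^sup>*"
    proof (cases "w = v")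
      case True
      then show ?thesis using assms(2) not_sym[OF w(1)] not_sym[OF w(2)] r by (auto simp: separating_def)
    next
      case False
      then show ?thesis
        using inseparable_remove_vertex[OF vx] inseparable_remove_vertex[OF that(2)] w
        by (meson rtrancl_trans)
    qed
  qed
  have "\<exists>x\<in>anchor E v. \<exists>y\<in>anchor E v. x \<noteq> y"
    using inseparable_edge[OF assms(3)] inseparable_refl[of E v] assms(4) unfolding anchor by blast
  moreover have "\<forall>x\<in>anchor E v. \<forall>y\<in>anchor E v. inseparable E x y"
    using clique unfolding anchor by blast
  moreover have "\<forall>z. (\<forall>x\<in>anchor E v. inseparable E x z) \<longrightarrow> z \<in> anchor E v"
    using inseparable_refl[of E v] unfolding anchor by blast
  ultimately show "maximal_inseparable E (anchor E v)"
    unfolding maximal_inseparable_def by (intro conjI)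
  show "K = anchor E v" if K: "maximal_inseparable E K" "v \<in> K"
  proof -
    have vK: "inseparable E v x" if "x \<in> K" for x
      using K that unfolding maximal_inseparable_def by blast
    have "z \<in> K" if "inseparable E v z" for z
    proof -
      have "\<forall>x\<in>K. inseparable E x z" using vK clique that by blast
      then show ?thesis using K(1) unfolding maximal_inseparable_def by blast
    qed
    with vK show ?thesis unfolding anchor by blast
  qed
qed

lemma anchor_reachable: "x \<in> anchor E v \<Longrightarrow> (v, x) \<in> E\<^sup>*"
  by (auto simp: anchor_def inseparable_def)

subsection \<open>Restriction to unions of components and relabelling\<close>

lemma rtrancl_Int_closed:
  assumes "R `` C \<subseteq> C" "x \<in> C"
  shows "(x, y) \<in> (R \<inter> C \<times> C)\<^sup>* \<longleftrightarrow> (x, y) \<in> R\<^sup>*"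
proof
  assume "(x, y) \<in> R\<^sup>*"
  then have "(x, y) \<in> (R \<inter> C \<times> C)\<^sup>* \<and> y \<in> C"
  proof induction
    case (step y z)
    then show ?case using assms(1) by (auto intro: rtrancl.rtrancl_into_rtrancl)
  qed (use assms in simp)
  then show "(x, y) \<in> (R \<inter> C \<times> C)\<^sup>*" ..
qed (meson Int_lower1 rtrancl_mono subsetD)

lemma remove_vertex_Int: "remove_vertex (E \<inter> C \<times> C) w = remove_vertex E w \<inter> C \<times> C"
  by (auto simp: remove_vertex_def)

lemma rtrancl_remove_vertex_Int_closed:
  assumes "E `` C \<subseteq> C" "x \<in> C"
  shows "(x, y) \<in> (remove_vertex (E \<inter> C \<times> C) w)\<^sup>* \<longleftrightarrow> (x, y) \<in> (remove_vertex E w)\<^sup>*"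
  unfolding remove_vertex_Int using assms by (intro rtrancl_Int_closed) (auto simp: remove_vertex_def)

lemma inseparable_Int_closed:
  "E `` C \<subseteq> C \<Longrightarrow> x \<in> C \<Longrightarrow> inseparable (E \<inter> C \<times> C) x y \<longleftrightarrow> inseparable E x y"
  by (simp add: inseparable_def rtrancl_Int_closed rtrancl_remove_vertex_Int_closed)

lemma maximal_inseparable_Int_closed:
  assumes "E `` C \<subseteq> C" "K \<subseteq> C" "maximal_inseparable E K"
  shows "maximal_inseparable (E \<inter> C \<times> C) K"
proof -
  have "inseparable (E \<inter> C \<times> C) x y \<longleftrightarrow> inseparable E x y" if "x \<in> K" for x y
    using assms that by (intro inseparable_Int_closed) auto
  with assms(3) show ?thesis unfolding maximal_inseparable_def by blast
qed

lemma reachable_avoids_or_meets: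
  "(x, y) \<in> E\<^sup>* \<Longrightarrow> (x, y) \<in> (remove_vertex E w)\<^sup>* \<or> (x, w) \<in> E\<^sup>*"
proof (induction rule: converse_rtrancl_induct)
  case (step x z)
  show ?case
  proof (cases "(x, w) \<in> E\<^sup>*")
    case False
    then have "(x, z) \<in> remove_vertex E w" "(z, w) \<notin> E\<^sup>*"
      using step(1) by (auto simp: remove_vertex_def intro: converse_rtrancl_into_rtrancl)
    with step.IH show ?thesis by (meson converse_rtrancl_into_rtrancl)
  qed simp
qed simp

text \<open>Vertices disconnected by the removal of \<open>v\<close> were joined through
  \<open>v\<close>, so they lie in the part that contains \<open>v\<close>.\<close>

lemma separating_Int_closed:
  assumes "E `` C \<subseteq> C" "v \<in> C" "sym E" "separating E v"
  shows "separating (E \<inter> C \<times> C) v"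
proof -
  obtain x y where xy: "x \<noteq> v" "y \<noteq> v" "(x, y) \<in> E\<^sup>*" "(x, y) \<notin> (remove_vertex E v)\<^sup>*"
    using assms(4) by (auto simp: separating_def)
  then have "(v, x) \<in> E\<^sup>*" using reachable_avoids_or_meets sym_rtranclD[OF assms(3)] by metis
  then have "(v, x) \<in> (E \<inter> C \<times> C)\<^sup>*" using rtrancl_Int_closed[OF assms(1,2)] by simp
  then have "x \<in> C" using rtrancl_in[of v x "E \<inter> C \<times> C" C] assms(2) by auto
  with xy show ?thesis
    unfolding separating_def using rtrancl_Int_closed[OF assms(1)] rtrancl_remove_vertex_Int_closed[OF assms(1)]
    by blast
qed

section \<open>Transport along injective maps\<close>

lemma rtrancl_map_prod_iff:
  assumes "inj f"
  shows "(f x, u) \<in> (map_prod f f ` E)\<^sup>* \<longleftrightarrow> (\<exists>y. u = f y \<and> (x, y) \<in> E\<^sup>*)"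
proof
  assume "(f x, u) \<in> (map_prod f f ` E)\<^sup>*"
  then show "\<exists>y. u = f y \<and> (x, y) \<in> E\<^sup>*"
  proof induction
    case (step u u')
    then obtain y y' z where "u = f y" "(x, y) \<in> E\<^sup>*" "u = f z" "u' = f y'" "(z, y') \<in> E" by auto
    then show ?case using assms by (auto dest: injD intro: rtrancl.rtrancl_into_rtrancl)
  qed auto
next
  assume "\<exists>y. u = f y \<and> (x, y) \<in> E\<^sup>*"
  then obtain y where "u = f y" "(x, y) \<in> E\<^sup>*" by blast
  from this(2) have "(f x, f y) \<in> (map_prod f f ` E)\<^sup>*"
    by induction (auto intro: rtrancl.rtrancl_into_rtrancl)
  then show "(f x, u) \<in> (map_prod f f ` E)\<^sup>*" using \<open>u = f y\<close> by simp
qed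

lemma remove_vertex_map_prod:
  "inj f \<Longrightarrow> remove_vertex (map_prod f f ` E) (f w) = map_prod f f ` remove_vertex E w"
  by (auto simp: remove_vertex_def inj_eq)

text \<open>The removed vertex may lie outside the range of \<open>f\<close>; then no edge is lost,
  and reachability alone suffices.\<close>

lemma inseparable_map_prod:
  assumes "inj f"
  shows "inseparable (map_prod f f ` E) (f x) (f y) \<longleftrightarrow> inseparable E x y"
proof -
  have "remove_vertex (map_prod f f ` E) w = map_prod f f ` E" if "w \<notin> range f" for w
    using that by (auto simp: remove_vertex_def)
  then have outside: "(f x, f y) \<in> (remove_vertex (map_prod f f ` E) w)\<^sup>*"
    if "(x, y) \<in> E\<^sup>*" "w \<notin> range f" for w
    using that assms by (simp add: rtrancl_map_prod_iff inj_eq)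
  have inside: "(f x, f y) \<in> (remove_vertex (map_prod f f ` E) (f w))\<^sup>* \<longleftrightarrow> (x, y) \<in> (remove_vertex E w)\<^sup>*" for w
    using assms by (simp add: remove_vertex_map_prod rtrancl_map_prod_iff inj_eq)
  have reach: "(f x, f y) \<in> (map_prod f f ` E)\<^sup>* \<longleftrightarrow> (x, y) \<in> E\<^sup>*"
    using assms by (simp add: rtrancl_map_prod_iff inj_eq)
  show ?thesis
  proof
    assume *: "inseparable (map_prod f f ` E) (f x) (f y)"
    show "inseparable E x y"
      unfolding inseparable_def
    proof (intro conjI allI impI)
      show "(x, y) \<in> E\<^sup>*" using * reach by (simp add: inseparable_def)
      fix w assume "w \<noteq> x" "w \<noteq> y"
      then show "(x, y) \<in> (remove_vertex E w)\<^sup>*"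
        using inseparable_remove_vertex[OF *, of "f w"] inside[of w] inj_eq[OF assms] by simp
    qed
  next
    assume *: "inseparable E x y"
    show "inseparable (map_prod f f ` E) (f x) (f y)"
      unfolding inseparable_def
    proof (intro conjI allI impI)
      show "(f x, f y) \<in> (map_prod f f ` E)\<^sup>*" using * reach by (simp add: inseparable_def)
      fix w assume w: "w \<noteq> f x" "w \<noteq> f y"
      show "(f x, f y) \<in> (remove_vertex (map_prod f f ` E) w)\<^sup>*"
      proof (cases "w \<in> range f")
        case True
        then obtain v where "w = f v" by blast
        then show ?thesis using w inside[of v] inseparable_remove_vertex[OF *, of v] by auto
      next
        case False
        then show ?thesis using outside inseparable_reachable[OF *] by simp
      qed
    qed
  qed
qed

lemma separating_map_prod:
  assumes "inj f"
  shows "separating (map_prod f f ` E) (f v) \<longleftrightarrow> separating E v"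
proof
  assume "separating (map_prod f f ` E) (f v)"
  then obtain x y where xy: "x \<noteq> f v" "y \<noteq> f v" "(x, y) \<in> (map_prod f f ` E)\<^sup>*"
      "(x, y) \<notin> (remove_vertex (map_prod f f ` E) (f v))\<^sup>*"
    by (auto simp: separating_def)
  then have "x \<noteq> y" by auto
  then obtain x' where x': "x = f x'" using xy(3) by (auto elim: converse_rtranclE)
  then obtain y' where "y = f y'" "(x', y') \<in> E\<^sup>*" using xy(3) assms by (auto simp: rtrancl_map_prod_iff)
  with xy x' assms show "separating E v"
    unfolding separating_def by (auto simp: remove_vertex_map_prod rtrancl_map_prod_iff inj_eq)
next
  assume "separating E v"
  then obtain x y where "x \<noteq> v" "y \<noteq> v" "(x, y) \<in> E\<^sup>*" "(x, y) \<notin> (remove_vertex E v)\<^sup>*"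
    by (auto simp: separating_def)
  then have "f x \<noteq> f v \<and> f y \<noteq> f v \<and> (f x, f y) \<in> (map_prod f f ` E)\<^sup>* \<and>
      (f x, f y) \<notin> (remove_vertex (map_prod f f ` E) (f v))\<^sup>*"
    using assms by (simp add: remove_vertex_map_prod rtrancl_map_prod_iff inj_eq)
  then show "separating (map_prod f f ` E) (f v)" unfolding separating_def by blast
qed

lemma anchor_map_prod:
  assumes "inj f"
  shows "anchor (map_prod f f ` E) (f v) = f ` anchor E v"
proof -
  have "u \<in> range f" if "inseparable (map_prod f f ` E) (f v) u" for u
    using inseparable_reachable[OF that] assms by (auto simp: rtrancl_map_prod_iff)
  then have "inseparable (map_prod f f ` E) (f v) u \<longleftrightarrow> (\<exists>x. u = f x \<and> inseparable E v x)" for u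
    using inseparable_map_prod[OF assms] by blast
  then show ?thesis
    unfolding anchor_def separating_map_prod[OF assms] by auto
qed

section \<open>Graphs through their edge relations\<close>

lemma graph_edges:
  assumes "graph G"
  shows "finite (verts G)" "arcs_ends G \<subseteq> verts G \<times> verts G" "sym (arcs_ends G)" "(x, x) \<notin> arcs_ends G"
proof -
  interpret graph G by fact
  show "finite (verts G)" by simp
  show "arcs_ends G \<subseteq> verts G \<times> verts G" using adj_in_verts by auto
  show "sym (arcs_ends G)" using sym_arcs by (simp add: symmetric_def)
  show "(x, x) \<notin> arcs_ends G" using adj_not_same by blast
qed

lemma reachable_iff_rtrancl:
  assumes "graph G" "x \<in> verts G"
  shows "x \<rightarrow>\<^sup>*\<^bsub>G\<^esub> y \<longleftrightarrow> (x, y) \<in> (arcs_ends G)\<^sup>*"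
proof -
  interpret graph G by fact
  show ?thesis using reachable_conv'[OF assms(2)] .
qed

lemma connected_iff:
  assumes "graph G"
  shows "Digraph_Component.connected G \<longleftrightarrow>
    verts G \<noteq> {} \<and> (\<forall>x\<in>verts G. \<forall>y\<in>verts G. (x, y) \<in> (arcs_ends G)\<^sup>*)"
proof -
  interpret graph G by fact
  show ?thesis
    unfolding connected_def strongly_connected_def
    using reachable_mk_symmetric_eq[OF sym_arcs] reachable_iff_rtrancl[OF assms] by auto
qed

lemma components_eq:
  assumes "graph G"
  shows "components G = (\<lambda>x. {y. (x, y) \<in> (arcs_ends G)\<^sup>*}) ` verts G"
proof -
  interpret graph G by fact
  have scc: "scc_of x = {y. (x, y) \<in> (arcs_ends G)\<^sup>*}" if "x \<in> verts G" for x
    unfolding scc_of_def using reachable_iff_rtrancl[OF assms that] symmetric_reachable' by auto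
  show ?thesis unfolding sccs_verts_conv_scc_of using scc by auto
qed

lemma graph_if_subgraph:
  assumes "graph G" "verts H \<subseteq> verts G" "arcs H \<subseteq> arcs G" "tail H = tail G" "head H = head G"
    and "\<And>e. e \<in> arcs H \<Longrightarrow> tail G e \<in> verts H \<and> head G e \<in> verts H" and "sym (arcs_ends H)"
  shows "graph H" "subgraph H G"
proof -
  interpret graph G by fact
  have "wf_digraph H" using assms by unfold_locales auto
  then show sub: "subgraph H G"
    using assms wf_digraph by (intro subgraphI) (auto simp: compatible_def)
  interpret H: digraph H using digraph_subgraph[OF sub] .
  show "graph H" using assms(7) by (intro H.graphI) (simp add: symmetric_def)
qed

lemma arcs_ends_induce: "arcs_ends (induce_subgraph G S) = arcs_ends G \<inter> S \<times> S"
  by (auto simp: arcs_ends_conv)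

lemma arcs_ends_del_vert: "arcs_ends (pre_digraph.del_vert G v) = remove_vertex (arcs_ends G) v"
  by (auto simp: arcs_ends_conv pre_digraph.del_vert_simps remove_vertex_def)

lemma graph_induce:
  assumes "graph G" "S \<subseteq> verts G"
  shows "graph (induce_subgraph G S)" "subgraph (induce_subgraph G S) G"
  using assms graph_edges(3)[OF assms(1)]
  by (auto intro!: graph_if_subgraph[OF assms(1)] simp: arcs_ends_induce) (auto simp: sym_def)

lemma graph_del_vert:
  assumes "graph G"
  shows "graph (pre_digraph.del_vert G v)" "subgraph (pre_digraph.del_vert G v) G"
proof -
  interpret graph G by fact
  show "graph (del_vert v)" "subgraph (del_vert v) G"
    using sym_remove_vertex[OF graph_edges(3)[OF assms]]
    by (auto intro!: graph_if_subgraph[OF assms] simp: arcs_ends_del_vert pre_digraph.del_vert_simps)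
qed

text \<open>The map \<open>f\<close> sends a component of the graph without \<open>v\<close> to the
  component of the whole graph containing it. If \<open>v\<close> separates, \<open>f\<close> is
  onto all components but not injective; otherwise it is injective.\<close>

lemma cut_vertex_iff:
  assumes G: "graph G" and v: "v \<in> verts G"
  shows "cut_vertex G v \<longleftrightarrow> verts G = {v} \<or> separating (arcs_ends G) v"
proof -
  define E where "E = arcs_ends G"
  define P where "P x = {y. (x, y) \<in> E\<^sup>*}" for x
  define Q where "Q x = {y. (x, y) \<in> (remove_vertex E v)\<^sup>*}" for x
  have symE: "sym E" using graph_edges(3)[OF G] by (simp add: E_def)
  have compG: "components G = P ` verts G"
    unfolding components_eq[OF G] P_def E_def ..
  have compD: "components (pre_digraph.del_vert G v) = Q ` (verts G - {v})"
    unfolding components_eq[OF graph_del_vert(1)[OF G]] Q_def E_def arcs_ends_del_vert pre_digraph.del_vert_simps ..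
  have finite: "finite (verts G)" using graph_edges[OF G] by simp
  have P_eq: "P x = P y \<longleftrightarrow> (x, y) \<in> E\<^sup>*" for x y
    unfolding P_def using symE by (auto intro: rtrancl_trans dest: sym_rtranclD)
  have Q_eq: "Q x = Q y \<longleftrightarrow> (x, y) \<in> (remove_vertex E v)\<^sup>*" for x y
    unfolding Q_def using sym_remove_vertex[OF symE] by (auto intro: rtrancl_trans dest: sym_rtranclD)
  define f where "f = P \<circ> (\<lambda>C. SOME x. x \<in> C)"
  have f: "f (Q x) = P x" for x
  proof -
    have "(SOME y. y \<in> Q x) \<in> Q x" by (rule someI[of _ x]) (simp add: Q_def)
    then have "(x, SOME y. y \<in> Q x) \<in> E\<^sup>*" by (auto simp: Q_def dest: rtrancl_remove_vertex_subset)
    then show ?thesis unfolding f_def comp_def using P_eq by blast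
  qed
  show ?thesis
  proof (cases "separating E v")
    case True
    then obtain x y where xy: "x \<noteq> v" "y \<noteq> v" "(x, y) \<in> E\<^sup>*" "(x, y) \<notin> (remove_vertex E v)\<^sup>*"
      by (auto simp: separating_def)
    then have "x \<noteq> y" by auto
    then have V: "x \<in> verts G" "y \<in> verts G"
      using rtrancl_in[OF xy(3), of "verts G"] graph_edges(2)[OF G] by (auto simp: E_def)
    \<comment> \<open>As \<open>x\<close> reaches \<open>v\<close>, the vertex \<open>v\<close>
      contributes no component of its own.\<close>
    have "P x = P v" using reachable_avoids_or_meets[OF xy(3), of v] xy(4) P_eq by blast
    then have "P ` verts G = P ` (verts G - {v})" using V(1) xy(1) by blast
    also have "\<dots> = f ` Q ` (verts G - {v})" by (simp add: image_image f)
    finally have img: "P ` verts G = f ` Q ` (verts G - {v})" .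
    have "f (Q x) = f (Q y)" "Q x \<noteq> Q y" using f P_eq Q_eq xy by auto
    then have "\<not> inj_on f (Q ` (verts G - {v}))" using V xy by (auto simp: inj_on_def)
    then have "card (P ` verts G) < card (Q ` (verts G - {v}))"
      unfolding img using finite by (meson card_image_le eq_card_imp_inj_on finite_Diff finite_imageI le_neq_implies_less)
    then show ?thesis using True v by (simp add: cut_vertex_def compG compD E_def)
  next
    case False
    have "inj_on f (Q ` (verts G - {v}))"
    proof (rule inj_onI)
      fix C D assume "C \<in> Q ` (verts G - {v})" "D \<in> Q ` (verts G - {v})" and eq: "f C = f D"
      then obtain x y where "C = Q x" "D = Q y" "x \<noteq> v" "y \<noteq> v" by blast
      then show "C = D" using eq False P_eq Q_eq f unfolding separating_def by metis
    qed
    then have "card (Q ` (verts G - {v})) = card (f ` Q ` (verts G - {v}))" by (simp add: card_image)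
    also have "\<dots> = card (P ` (verts G - {v}))" by (simp add: image_image f)
    also have "\<dots> \<le> card (P ` verts G)" using finite by (intro card_mono) auto
    finally show ?thesis using False v by (simp add: cut_vertex_def compG compD E_def)
  qed
qed

lemma two_connected_iff:
  assumes G: "graph G"
  shows "two_connected G \<longleftrightarrow> (\<exists>x\<in>verts G. \<exists>y\<in>verts G. x \<noteq> y) \<and>
    (\<forall>x\<in>verts G. \<forall>y\<in>verts G. inseparable (arcs_ends G) x y)"
proof -
  have V: "arcs_ends G \<subseteq> verts G \<times> verts G" using graph_edges[OF G] by simp
  have out: "remove_vertex (arcs_ends G) w = arcs_ends G" if "w \<notin> verts G" for w
    using remove_vertex_outside[OF V that] .
  have "two_connected G \<longleftrightarrow> (verts G \<noteq> {} \<and> (\<forall>v\<in>verts G. verts G - {v} \<noteq> {})) \<and>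
      (\<forall>x\<in>verts G. \<forall>y\<in>verts G. (x, y) \<in> (arcs_ends G)\<^sup>*) \<and>
      (\<forall>w\<in>verts G. \<forall>x\<in>verts G - {w}. \<forall>y\<in>verts G - {w}. (x, y) \<in> (remove_vertex (arcs_ends G) w)\<^sup>*)"
    unfolding two_connected_def connected_iff[OF G] connected_iff[OF graph_del_vert(1)[OF G]] pre_digraph.del_vert_simps
      arcs_ends_del_vert using G by blast
  also have "verts G \<noteq> {} \<and> (\<forall>v\<in>verts G. verts G - {v} \<noteq> {}) \<longleftrightarrow> (\<exists>x\<in>verts G. \<exists>y\<in>verts G. x \<noteq> y)"
    by blast
  finally show ?thesis
    unfolding inseparable_def using out by (metis Diff_iff singletonD singletonI)
qed

lemma inseparable_mono: "inseparable E x y \<Longrightarrow> E \<subseteq> E' \<Longrightarrow> inseparable E' x y"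
proof -
  assume *: "inseparable E x y" "E \<subseteq> E'"
  then have "remove_vertex E w \<subseteq> remove_vertex E' w" for w by (auto simp: remove_vertex_def)
  then show ?thesis using * unfolding inseparable_def by (meson rtrancl_mono subsetD)
qed

text \<open>Convexity, applied to the edge relation and to each of its vertex removals, keeps the
  connecting walks inside \<open>K\<close>.\<close>

lemma maximal_inseparable_two_connected:
  assumes G: "graph G" and K: "maximal_inseparable (arcs_ends G) K"
  shows "K \<subseteq> verts G" "two_connected (induce_subgraph G K)"
proof -
  define E where "E = arcs_ends G"
  have E: "sym E" "E \<subseteq> verts G \<times> verts G" using graph_edges[OF G] by (auto simp: E_def)
  have K': "\<exists>x\<in>K. \<exists>y\<in>K. x \<noteq> y" "\<And>x y. x \<in> K \<Longrightarrow> y \<in> K \<Longrightarrow> inseparable E x y"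
    using K unfolding maximal_inseparable_def E_def by blast+
  show "K \<subseteq> verts G"
  proof
    fix x assume "x \<in> K"
    then obtain y where "y \<in> K" "x \<noteq> y" using K'(1) by metis
    then show "x \<in> verts G"
      using rtrancl_in[OF inseparable_reachable[OF K'(2)[OF \<open>x \<in> K\<close>]] E(2)] by blast
  qed
  then have gr: "graph (induce_subgraph G K)" using graph_induce[OF G] by blast
  have "inseparable (E \<inter> K \<times> K) x y" if "x \<in> K" "y \<in> K" for x y
    unfolding inseparable_def
  proof (intro conjI allI impI)
    have xy: "inseparable E x y" using K'(2) that .
    show "(x, y) \<in> (E \<inter> K \<times> K)\<^sup>*"
      using maximal_inseparable_convex[OF E(1) K[folded E_def] order_refl that] inseparable_reachable[OF xy] .
    fix w assume w: "w \<noteq> x" "w \<noteq> y"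
    have "remove_vertex E w \<subseteq> E" by (auto simp: remove_vertex_def)
    from maximal_inseparable_convex[OF E(1) K[folded E_def] this that] inseparable_remove_vertex[OF xy w]
    show "(x, y) \<in> (remove_vertex (E \<inter> K \<times> K) w)\<^sup>*" by (simp add: remove_vertex_Int)
  qed
  then show "two_connected (induce_subgraph G K)"
    using K'(1) unfolding two_connected_iff[OF gr] arcs_ends_induce E_def[symmetric] by simp
qed

text \<open>The vertices of a block extend to a maximal inseparable set, whose induced subgraph is
  2-connected and contains the block, so maximality identifies the two. Conversely, a 2-connected
  graph above the induced subgraph has pairwise inseparable vertices, so it gains neither vertices
  nor arcs.\<close>

lemma is_block_iff:
  assumes G: "graph G"
  shows "is_block G R \<longleftrightarrow> maximal_inseparable (arcs_ends G) R"
proof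
  assume "is_block G R"
  then obtain B where B: "subgraph B G" "two_connected B" "verts B = R"
    and max: "\<And>H. H \<noteq> B \<Longrightarrow> subgraph B H \<Longrightarrow> subgraph H G \<Longrightarrow> \<not> two_connected H"
    unfolding is_block_def pre_digraph.max_subgraph_def by blast
  have "graph B" using B(2) by (simp add: two_connected_def)
  have "\<exists>x\<in>R. \<exists>y\<in>R. x \<noteq> y" and "\<forall>x\<in>R. \<forall>y\<in>R. inseparable (arcs_ends G) x y"
    using B(2,3) inseparable_mono[OF _ arcs_ends_mono[OF B(1)]] unfolding two_connected_iff[OF \<open>graph B\<close>]
    by blast+
  from inseparable_set_extend[OF graph_edges(1,2)[OF G] this graph_edges(3)[OF G]]
  obtain K where K: "R \<subseteq> K" "maximal_inseparable (arcs_ends G) K" .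
  note tc = maximal_inseparable_two_connected[OF G K(2)]
  have "subgraph B (induce_subgraph G K)"
  proof -
    have B': "verts B \<subseteq> verts G" "arcs B \<subseteq> arcs G" "compatible G B" "wf_digraph B"
      using B(1) by (auto simp: subgraph_def)
    have "tail G e \<in> K \<and> head G e \<in> K" if "e \<in> arcs B" for e
      using that B'(3) wf_digraph.wellformed[OF B'(4) that] B(3) K(1) by (auto simp: compatible_def)
    then show ?thesis
      using B' B(3) K(1) graph_induce(2)[OF G tc(1)] by (auto simp: subgraph_def compatible_def)
  qed
  then have "induce_subgraph G K = B" using max graph_induce(2)[OF G tc(1)] tc(2) by blast
  then have "K = R" using B(3) by auto
  with K(2) show "maximal_inseparable (arcs_ends G) R" by simp
next
  assume R: "maximal_inseparable (arcs_ends G) R"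
  note tc = maximal_inseparable_two_connected[OF G R]
  let ?B = "induce_subgraph G R"
  have "H = ?B" if H: "subgraph ?B H" "subgraph H G" "two_connected H" for H
  proof -
    have "graph H" using H(3) by (simp add: two_connected_def)
    have "R \<subseteq> verts H" using H(1) by (auto simp: subgraph_def)
    have "inseparable (arcs_ends G) x y" if "x \<in> verts H" "y \<in> verts H" for x y
      using H(3) that inseparable_mono[OF _ arcs_ends_mono[OF H(2)]]
      unfolding two_connected_iff[OF \<open>graph H\<close>] by blast
    then have "verts H \<subseteq> R" using R \<open>R \<subseteq> verts H\<close> unfolding maximal_inseparable_def by blast
    then have "verts H = R" using \<open>R \<subseteq> verts H\<close> by blast
    moreover have "tail H = tail G" "head H = head G" using H(2) by (auto simp: subgraph_def compatible_def)
    moreover have "arcs H = arcs ?B"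
    proof
      show "arcs ?B \<subseteq> arcs H" using H(1) by (auto simp: subgraph_def)
      show "arcs H \<subseteq> arcs ?B"
      proof
        fix e assume e: "e \<in> arcs H"
        have "wf_digraph H" "arcs H \<subseteq> arcs G" using H(2) by (auto simp: subgraph_def)
        then show "e \<in> arcs ?B"
          using e wf_digraph.wellformed[OF _ e] \<open>verts H = R\<close> \<open>tail H = tail G\<close> \<open>head H = head G\<close>
          by auto
      qed
    qed
    ultimately show ?thesis by (intro pre_digraph.equality) auto
  qed
  then have "pre_digraph.max_subgraph G two_connected ?B"
    unfolding pre_digraph.max_subgraph_def using tc graph_induce(2)[OF G tc(1)] by blast
  then show "is_block G R" unfolding is_block_def by force
qed

lemma isolated_reachable: "\<nexists>w. (v, w) \<in> E \<Longrightarrow> (v, x) \<in> E\<^sup>* \<longleftrightarrow> x = v"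
  by (auto elim: converse_rtranclE)

text \<open>The definite description denotes because a vertex that neither separates nor is isolated
  lies in exactly one maximal inseparable set; in the remaining cases both sides are the
  singleton.\<close>

lemma rho_eq:
  assumes G: "graph G" and v: "v \<in> verts G"
  shows "rho G v = anchor (arcs_ends G) v"
proof (cases "separating (arcs_ends G) v \<or> (\<nexists>w. (v, w) \<in> arcs_ends G)")
  case True
  then have "anchor (arcs_ends G) v = {v}"
    using isolated_reachable[of v "arcs_ends G"] by (auto simp: anchor_def dest: inseparable_reachable)
  then show ?thesis using True cut_vertex_iff[OF G v] by (auto simp: rho_def)
next
  case False
  then obtain u where u: "(v, u) \<in> arcs_ends G" by blast
  then have "u \<noteq> v" "u \<in> verts G" using graph_edges[OF G] by auto
  then have "\<not> cut_vertex G v" using cut_vertex_iff[OF G v] False by auto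
  then have "rho G v = (THE B. maximal_inseparable (arcs_ends G) B \<and> v \<in> B)"
    using u by (auto simp: rho_def is_block_iff[OF G])
  also have "\<dots> = anchor (arcs_ends G) v"
  proof (rule the_equality)
    have "\<not> separating (arcs_ends G) v" using False by blast
    note anchor = maximal_inseparable_anchor[OF graph_edges(3)[OF G] this u \<open>u \<noteq> v\<close>]
    show "maximal_inseparable (arcs_ends G) (anchor (arcs_ends G) v) \<and> v \<in> anchor (arcs_ends G) v"
      using anchor(1) by (simp add: anchor_def)
    show "B = anchor (arcs_ends G) v" if "maximal_inseparable (arcs_ends G) B \<and> v \<in> B" for B
      using anchor(2) that by blast
  qed
  finally show ?thesis .
qed

section \<open>Anchored graphs from one representative per component\<close>

definition transversal :: "('a, 'e) pre_digraph \<Rightarrow> 'a set \<Rightarrow> bool" where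
  "transversal G R \<longleftrightarrow> R \<subseteq> verts G \<and> (\<forall>x\<in>verts G. \<exists>!r. r \<in> R \<and> (x, r) \<in> (arcs_ends G)\<^sup>*)"

text \<open>All of \<open>rho G r\<close> is reachable from \<open>r\<close>, so a component meets
  the union only in the set of its own representative. That set is a block of the component, or a
  singleton if \<open>r\<close> separates or is isolated; in the isolated case the component has one
  vertex, a cut vertex by convention.\<close>

lemma anchored_graph_rho:
  assumes G: "graph G" and R: "transversal G R"
  shows "anchored_graph G (\<Union>r\<in>R. rho G r)"
proof -
  define E where "E = arcs_ends G"
  note [simp] = E_def[symmetric]
  have E: "finite (verts G)" "E \<subseteq> verts G \<times> verts G" "sym E" using graph_edges[OF G] by auto
  have RV: "R \<subseteq> verts G" and ex1: "\<And>x. x \<in> verts G \<Longrightarrow> \<exists>!r. r \<in> R \<and> (x, r) \<in> E\<^sup>*"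
    using R by (auto simp: transversal_def)
  have rho: "rho G r = anchor E r" if "r \<in> R" for r using rho_eq[OF G] that RV by auto
  have sub: "anchor E r \<subseteq> verts G" if "r \<in> R" for r
    using anchor_reachable[of _ E r] rtrancl_in[OF _ E(2)] RV that by blast
  have "connected_anchored_graph (induce_subgraph G C) ((\<Union>r\<in>R. rho G r) \<inter> C)" if "C \<in> components G" for C
  proof -
    obtain x where x: "x \<in> verts G" and C: "C = {y. (x, y) \<in> E\<^sup>*}"
      using \<open>C \<in> components G\<close> unfolding components_eq[OF G] by auto
    obtain r where r: "r \<in> R" "(x, r) \<in> E\<^sup>*" and uniq: "\<And>r'. r' \<in> R \<Longrightarrow> (x, r') \<in> E\<^sup>* \<Longrightarrow> r' = r"
      using ex1[OF x] by blast
    have CV: "C \<subseteq> verts G" using C x rtrancl_in[OF _ E(2)] by blast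
    have closed: "E `` C \<subseteq> C" unfolding C by (auto intro: rtrancl.rtrancl_into_rtrancl)
    have rC: "r \<in> C" using r C by simp
    have inC: "y \<in> C \<longleftrightarrow> (r, y) \<in> E\<^sup>*" for y
      unfolding C using r(2) sym_rtranclD[OF E(3)] by (auto intro: rtrancl_trans)
    have inter: "(\<Union>r\<in>R. rho G r) \<inter> C = anchor E r"
    proof
      show "anchor E r \<subseteq> (\<Union>r\<in>R. rho G r) \<inter> C" using rho r inC anchor_reachable by fastforce
      show "(\<Union>r\<in>R. rho G r) \<inter> C \<subseteq> anchor E r"
      proof
        fix y assume "y \<in> (\<Union>r\<in>R. rho G r) \<inter> C"
        then obtain r' where r': "r' \<in> R" "y \<in> anchor E r'" "y \<in> C" using rho by auto
        have "(x, y) \<in> E\<^sup>*" using r'(3) C by simp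
        also have "(y, r') \<in> E\<^sup>*" using sym_rtranclD[OF E(3) anchor_reachable[OF r'(2)]] .
        finally have "r' = r" using uniq r' by blast
        with r' show "y \<in> anchor E r" by simp
      qed
    qed
    have gr: "graph (induce_subgraph G C)" using graph_induce(1)[OF G CV] .
    have "(a, b) \<in> E\<^sup>*" if "a \<in> C" "b \<in> C" for a b
      using that sym_rtranclD[OF E(3), of x a] unfolding C by (auto intro: rtrancl_trans)
    then have conn: "Digraph_Component.connected (induce_subgraph G C)"
      unfolding connected_iff[OF gr] arcs_ends_induce using rC rtrancl_Int_closed[OF closed] by auto
    have "(\<exists>s. anchor E r = {s} \<and> cut_vertex (induce_subgraph G C) s) \<or> is_block (induce_subgraph G C) (anchor E r)"
    proof (cases "separating E r \<or> (\<nexists>w. (r, w) \<in> E)")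
      case True
      then have "anchor E r = {r}"
        using isolated_reachable[of r E] by (auto simp: anchor_def dest: inseparable_reachable)
      moreover have "cut_vertex (induce_subgraph G C) r"
        using True
      proof
        assume "separating E r"
        then show ?thesis
          using cut_vertex_iff[OF gr] rC separating_Int_closed[OF closed rC E(3)]
          by (simp add: arcs_ends_induce)
      next
        assume "\<nexists>w. (r, w) \<in> E"
        then have "C = {r}" using inC isolated_reachable[of r E] by auto
        then show ?thesis by (simp add: cut_vertex_def)
      qed
      ultimately show ?thesis by blast
    next
      case False
      then obtain u where "(r, u) \<in> E" "u \<noteq> r" using graph_edges(4)[OF G] by auto
      with False have "maximal_inseparable E (anchor E r)" using maximal_inseparable_anchor[OF E(3)] by blast
      moreover have "anchor E r \<subseteq> C" using inC anchor_reachable by fast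
      ultimately have "maximal_inseparable (E \<inter> C \<times> C) (anchor E r)"
        using maximal_inseparable_Int_closed[OF closed] by blast
      then show ?thesis unfolding is_block_iff[OF gr] arcs_ends_induce by simp
    qed
    then show ?thesis unfolding connected_anchored_graph_def inter using gr conn by blast
  qed
  moreover have "(\<Union>r\<in>R. rho G r) \<subseteq> verts G" using rho sub by auto
  ultimately show ?thesis using G by (simp add: anchored_graph_def)
qed

text \<open>A single entry links no pairs. Multiplying it by the column sum of \<open>r\<close>,
  which is 1, produces a nonzero \<open>U s r * U a x\<close> with \<open>s\<close> in
  \<open>S\<close>, along which separation and inseparability are transferred. The converse uses the
  row sum of \<open>s\<close>.\<close>

lemma (in magic_graph) entry_anchor_iff:
  assumes R: "R \<subseteq> J" "S \<subseteq> I" and RS: "\<And>a x. a \<in> I \<Longrightarrow> x \<in> J \<Longrightarrow> U a x \<noteq> 0 \<Longrightarrow> x \<in> R \<longleftrightarrow> a \<in> S"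
    and a: "a \<in> I" and x: "x \<in> J" and ne: "U a x \<noteq> 0"
  shows "x \<in> (\<Union>r\<in>R. anchor E r) \<longleftrightarrow> a \<in> (\<Union>s\<in>S. anchor F s)"
proof -
  have transfer: "x \<in> anchor E r \<longleftrightarrow> a \<in> anchor F s" if "r \<in> J" "s \<in> I" and m: "U s r * U a x \<noteq> 0" for r s
    using compatD[OF compat_inseparable \<open>s \<in> I\<close> a \<open>r \<in> J\<close> x m]
      compatD[OF compat_separating \<open>s \<in> I\<close> a \<open>r \<in> J\<close> x m]
      compatD[OF compat_eq \<open>s \<in> I\<close> a \<open>r \<in> J\<close> x m]
    by (auto simp: anchor_def)
  show ?thesis
  proof
    assume "x \<in> (\<Union>r\<in>R. anchor E r)"
    then obtain r where r: "r \<in> R" "x \<in> anchor E r" by blast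
    have "(\<Sum>s\<in>I. U s r * U a x) = U a x"
      using sum_col[of r] r R by (simp add: sum_distrib_right[symmetric] subset_iff)
    with ne have "\<not> (\<forall>s\<in>I. U s r * U a x = 0)" by (metis (no_types, lifting) sum.neutral)
    then obtain s where s: "s \<in> I" "U s r * U a x \<noteq> 0" by blast
    then have "s \<in> S" using RS[of s r] r R by fastforce
    moreover have "a \<in> anchor F s" using transfer[of r s] s r R by blast
    ultimately show "a \<in> (\<Union>s\<in>S. anchor F s)" by blast
  next
    assume "a \<in> (\<Union>s\<in>S. anchor F s)"
    then obtain s where s: "s \<in> S" "a \<in> anchor F s" by blast
    have "(\<Sum>r\<in>J. U s r * U a x) = U a x"
      using sum_row[of s] s R by (simp add: sum_distrib_right[symmetric] subset_iff)
    with ne have "\<not> (\<forall>r\<in>J. U s r * U a x = 0)" by (metis (no_types, lifting) sum.neutral)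
    then obtain r where r: "r \<in> J" "U s r * U a x \<noteq> 0" by blast
    then have "r \<in> R" using RS[of s r] s R by fastforce
    moreover have "x \<in> anchor E r" using transfer[of r s] s r R by blast
    ultimately show "x \<in> (\<Union>r\<in>R. anchor E r)" by blast
  qed
qed

lemma magic_graphI:
  assumes "quantum_iso G H U"
  shows "magic_graph (verts H) (verts G) U (arcs_ends G) (arcs_ends H)"
  using assms graph_edges(2)[of G] graph_edges(2)[of H]
  unfolding quantum_iso_iff magic_graph_def magic_graph_axioms_def magic_def by simp

lemma anchored_quantum_iso_rho:
  assumes iso: "quantum_iso G H U" and R: "transversal G R" and S: "transversal H S"
    and RS: "\<And>a x. a \<in> verts H \<Longrightarrow> x \<in> verts G \<Longrightarrow> U a x \<noteq> 0 \<Longrightarrow> x \<in> R \<longleftrightarrow> a \<in> S"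
  shows "anchored_quantum_iso (G, \<Union>r\<in>R. rho G r) (H, \<Union>s\<in>S. rho H s) U"
proof -
  have G: "graph G" and H: "graph H" using iso by (auto simp: quantum_iso_iff)
  interpret magic_graph "verts H" "verts G" U "arcs_ends G" "arcs_ends H" using magic_graphI[OF iso] .
  have sub: "R \<subseteq> verts G" "S \<subseteq> verts H" using R S by (auto simp: transversal_def)
  have "(\<Union>r\<in>R. rho G r) = (\<Union>r\<in>R. anchor (arcs_ends G) r)"
    "(\<Union>s\<in>S. rho H s) = (\<Union>s\<in>S. anchor (arcs_ends H) s)"
    using sub rho_eq[OF G] rho_eq[OF H] by (meson SUP_cong subsetD)+
  moreover note entry_anchor_iff[OF sub RS]
  ultimately have "x \<in> (\<Union>r\<in>R. rho G r) \<longleftrightarrow> a \<in> (\<Union>s\<in>S. rho H s)"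
    if "a \<in> verts H" "x \<in> verts G" "U a x \<noteq> 0" for a x
    using that by simp
  then show ?thesis
    unfolding anchored_quantum_iso_def case_prod_conv
    using anchored_graph_rho[OF G R] anchored_graph_rho[OF H S] iso by blast
qed

section \<open>Deleting the edges of a block\<close>

lemma graph_with_proj:
  assumes "finite (pverts P)" "parcs P \<subseteq> pverts P \<times> pverts P" "sym (parcs P)" "\<And>x. (x, x) \<notin> parcs P"
  shows "graph (with_proj P)"
proof -
  have "finite (parcs P)" using assms(1,2) by (meson finite_SigmaI finite_subset)
  then show ?thesis
    using assms by unfold_locales (auto simp: arc_to_ends_def symmetric_def prod_eq_iff)
qed

lemma graph_relabel:
  assumes "inj f" "graph G" shows "graph (with_proj (relabel f G))"
  unfolding relabel_def using graph_edges[OF assms(2)] assms(1)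
  by (intro graph_with_proj) (auto simp: sym_def inj_eq)

lemma relabel_simps:
  "verts (with_proj (relabel f G)) = f ` verts G"
  "arcs_ends (with_proj (relabel f G)) = map_prod f f ` arcs_ends G"
  by (simp_all add: relabel_def)

lemma transversal_relabel:
  assumes "inj f" "transversal G R" shows "transversal (with_proj (relabel f G)) (f ` R)"
  using assms unfolding transversal_def relabel_simps
  by (auto simp: rtrancl_map_prod_iff inj_eq) (metis (full_types))

lemma rho_relabel:
  assumes "inj f" "graph G" "v \<in> verts G"
  shows "rho (with_proj (relabel f G)) (f v) = f ` rho G v"
proof -
  have "f v \<in> verts (with_proj (relabel f G))" using assms(3) unfolding relabel_simps by blast
  then show ?thesis
    using rho_eq[OF graph_relabel[OF assms(1,2)]] rho_eq[OF assms(2,3)] anchor_map_prod[OF assms(1)]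
    unfolding relabel_simps by simp
qed

lemma mem_map_prod_iff: "inj f \<Longrightarrow> (f x, f y) \<in> map_prod f f ` E \<longleftrightarrow> (x, y) \<in> E"
  by (force simp: inj_eq)

lemma quantum_iso_relabel:
  assumes iso: "quantum_iso G H U"
  shows "quantum_iso (with_proj (relabel Inl G)) (with_proj (relabel Inl H)) (Gamma_matrix w U)"
proof -
  have G: "graph G" and H: "graph H" and U: "magic_unitary (verts H) (verts G) U"
    using iso by (auto simp: quantum_iso_iff)
  interpret magic "verts H" "verts G" U using U by unfold_locales
  have V: "magic_unitary (Inl ` verts H) (Inl ` verts G) (Gamma_matrix w U)"
    using U by (auto simp: magic_unitary_def sum.reindex)
  interpret V: magic "Inl ` verts H" "Inl ` verts G" "Gamma_matrix w U" using V by unfold_locales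
  have "compat (\<lambda>x y. (x, y) \<in> arcs_ends G) (\<lambda>a b. (a, b) \<in> arcs_ends H)"
    using iso by (simp add: quantum_iso_iff)
  then have compat: "V.compat (\<lambda>x y. (x, y) \<in> map_prod Inl Inl ` arcs_ends G) (\<lambda>a b. (a, b) \<in> map_prod Inl Inl ` arcs_ends H)"
    unfolding compat_def V.compat_def by (simp add: mem_map_prod_iff[OF inj_Inl])
  show ?thesis
    unfolding quantum_iso_iff relabel_simps by (intro conjI graph_relabel inj_Inl G H V compat)
qed

lemma UN_rho_relabel:
  assumes "inj f" "graph G" "transversal G R"
  shows "(\<Union>v\<in>f ` R. rho (with_proj (relabel f G)) v) = f ` (\<Union>r\<in>R. rho G r)"
  unfolding image_UN image_image
  using rho_relabel[OF assms(1,2)] assms(3) by (intro SUP_cong) (auto simp: transversal_def)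

lemma anchored_quantum_iso_relabel:
  assumes iso: "quantum_iso G H U" and R: "transversal G R" and S: "transversal H S"
    and RS: "\<And>a x. a \<in> verts H \<Longrightarrow> x \<in> verts G \<Longrightarrow> U a x \<noteq> 0 \<Longrightarrow> x \<in> R \<longleftrightarrow> a \<in> S"
  shows "anchored_quantum_iso
    (with_proj (relabel Inl G), Inl ` (\<Union>r\<in>R. rho G r))
    (with_proj (relabel Inl H), Inl ` (\<Union>s\<in>S. rho H s)) (Gamma_matrix w U)"
proof -
  have "anchored_quantum_iso
    (with_proj (relabel Inl G), \<Union>v\<in>Inl ` R. rho (with_proj (relabel Inl G)) v)
    (with_proj (relabel Inl H), \<Union>v\<in>Inl ` S. rho (with_proj (relabel Inl H)) v) (Gamma_matrix w U)"
    using RS by (intro anchored_quantum_iso_rho quantum_iso_relabel iso transversal_relabel inj_Inl R S)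
      (unfold relabel_simps, auto)
  then show ?thesis
    using R S iso by (simp only: quantum_iso_iff UN_rho_relabel[OF inj_Inl])
qed

lemma del_edges_within_simps:
  "verts (del_edges_within G R) = verts G"
  "arcs_ends (del_edges_within G R) = arcs_ends G - R \<times> R"
  by (auto simp: del_edges_within_def arcs_ends_conv)

lemma graph_del_edges_within:
  assumes "graph G" shows "graph (del_edges_within G R)"
proof -
  interpret graph G by fact
  have sym: "sym (arcs_ends (del_edges_within G R))"
    unfolding del_edges_within_simps using graph_edges(3)[OF assms] by (auto simp: sym_def)
  show ?thesis
    by (rule graph_if_subgraph(1)[OF assms _ _ _ _ _ sym]) (auto simp: del_edges_within_def)
qed

text \<open>A walk to \<open>R\<close>, stopped at its first vertex of \<open>R\<close>, uses no
  deleted edge. Two vertices of \<open>R\<close> still joined would, by convexity, be joined inside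
  \<open>R\<close>, where no edge is left.\<close>

lemma transversal_del_edges_within:
  assumes G: "graph G" "Digraph_Component.connected G" and R: "is_block G R"
  shows "transversal (del_edges_within G R) R"
proof -
  define E where "E = arcs_ends G"
  have max: "maximal_inseparable E R" using R is_block_iff[OF G(1)] by (simp add: E_def)
  have symE: "sym E" using graph_edges(3)[OF G(1)] by (simp add: E_def)
  have RV: "R \<subseteq> verts G" using maximal_inseparable_two_connected(1)[OF G(1)] max by (simp add: E_def)
  have sym: "sym (E - R \<times> R)" using symE by (auto simp: sym_def)
  obtain r0 where r0: "r0 \<in> R" using max unfolding maximal_inseparable_def by blast
  have unique: "r = r'" if "r \<in> R" "r' \<in> R" "(r, r') \<in> (E - R \<times> R)\<^sup>*" for r r'
  proof -
    have "(E - R \<times> R) \<inter> R \<times> R = {}" by blast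
    then show ?thesis
      using maximal_inseparable_convex[OF symE max Diff_subset that] by simp
  qed
  have "\<exists>r. r \<in> R \<and> (x, r) \<in> (E - R \<times> R)\<^sup>*" if "x \<in> verts G" for x
  proof -
    have "(x, r0) \<in> E\<^sup>*" using G r0 RV that by (auto simp: connected_iff E_def)
    then show ?thesis
    proof (induction rule: converse_rtrancl_induct)
      case base
      then show ?case using r0 by blast
    next
      case (step y z)
      show ?case
      proof (cases "y \<in> R")
        case False
        with step have "(y, z) \<in> E - R \<times> R" by blast
        with step.IH show ?thesis by (meson converse_rtrancl_into_rtrancl)
      qed blast
    qed
  qed
  moreover have "r = r'" if "r \<in> R" "r' \<in> R" "(x, r) \<in> (E - R \<times> R)\<^sup>*" "(x, r') \<in> (E - R \<times> R)\<^sup>*" for x r r'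
    using unique[OF that(1,2)] sym_rtranclD[OF sym that(3)] that(4) by (meson rtrancl_trans)
  ultimately have "\<exists>!r. r \<in> R \<and> (x, r) \<in> (E - R \<times> R)\<^sup>*" if "x \<in> verts G" for x
    using that by blast
  then show ?thesis using RV by (simp add: transversal_def del_edges_within_simps E_def)
qed

lemma quantum_iso_del_edges_within:
  assumes iso: "quantum_iso G H U"
    and RS: "\<And>a x. a \<in> verts H \<Longrightarrow> x \<in> verts G \<Longrightarrow> U a x \<noteq> 0 \<Longrightarrow> x \<in> R \<longleftrightarrow> a \<in> S"
  shows "quantum_iso (del_edges_within G R) (del_edges_within H S) U"
proof -
  interpret magic "verts H" "verts G" U using iso by unfold_locales (simp add: quantum_iso_iff)
  have c: "compat (\<lambda>x y. (x, y) \<in> arcs_ends G) (\<lambda>a b. (a, b) \<in> arcs_ends H)"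
    using iso by (simp add: quantum_iso_iff)
  have "compat (\<lambda>x y. (x, y) \<in> arcs_ends G - R \<times> R) (\<lambda>a b. (a, b) \<in> arcs_ends H - S \<times> S)"
    unfolding compat_def
  proof (intro ballI impI)
    fix a b x y assume in_verts: "a \<in> verts H" "b \<in> verts H" "x \<in> verts G" "y \<in> verts G" and ne: "U a x * U b y \<noteq> 0"
    then have "U a x \<noteq> 0" "U b y \<noteq> 0" by auto
    then show "((x, y) \<in> arcs_ends G - R \<times> R) = ((a, b) \<in> arcs_ends H - S \<times> S)"
      using compatD[OF c in_verts ne] RS[of a x] RS[of b y] in_verts by simp
  qed
  then show ?thesis
    using iso unfolding quantum_iso_iff del_edges_within_simps by (simp add: graph_del_edges_within)
qed

section \<open>Splitting at a cut vertex\<close>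

lemma split_graph_verts:
  assumes "graph G" "r \<in> verts G" "verts G \<noteq> {r}"
  shows "pverts (split_graph G r) = (verts G - {r}) <+> components (pre_digraph.del_vert G r)"
proof -
  note comps = components_eq[OF graph_del_vert(1)[OF assms(1)], of r, unfolded pre_digraph.del_vert_simps]
  have sub: "C \<subseteq> verts G - {r} \<and> C \<noteq> {}" if "C \<in> components (pre_digraph.del_vert G r)" for C
    using that graph_edges(2)[OF graph_del_vert(1)[OF assms(1)], of r] unfolding comps
    by (auto simp: pre_digraph.del_vert_simps dest: rtrancl_in)
  moreover have "x \<in> (\<Union>(components (pre_digraph.del_vert G r)))" if "x \<in> verts G - {r}" for x
    using that unfolding comps by blast
  ultimately show ?thesis
    using assms(3) unfolding split_graph_def relabel_def Plus_def
    by (auto simp: split_label_def image_iff)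
qed

lemma mem_components_del_vert:
  assumes "graph G" "C \<in> components (pre_digraph.del_vert G r)" "x \<in> C"
  shows "C = {y. (x, y) \<in> (remove_vertex (arcs_ends G) r)\<^sup>*}" "x \<in> verts G - {r}"
proof -
  note comps = components_eq[OF graph_del_vert(1)[OF assms(1)], of r,
      unfolded pre_digraph.del_vert_simps arcs_ends_del_vert]
  have sym: "sym (remove_vertex (arcs_ends G) r)"
    using sym_remove_vertex[OF graph_edges(3)[OF assms(1)]] .
  obtain z where z: "z \<in> verts G - {r}" "C = {y. (z, y) \<in> (remove_vertex (arcs_ends G) r)\<^sup>*}"
    using assms(2) unfolding comps by blast
  then show "C = {y. (x, y) \<in> (remove_vertex (arcs_ends G) r)\<^sup>*}"
    using assms(3) sym_rtranclD[OF sym, of z x] by (auto intro: rtrancl_trans)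
  have "remove_vertex (arcs_ends G) r \<subseteq> (verts G - {r}) \<times> (verts G - {r})"
    using graph_edges(2)[OF assms(1)] by (auto simp: remove_vertex_def)
  then show "x \<in> verts G - {r}" using rtrancl_in[of z x] z assms(3) by blast
qed

lemma split_graph_edges:
  assumes "graph G" "verts G \<noteq> {r}"
  defines "Cs \<equiv> components (pre_digraph.del_vert G r)"
  shows "(Inl x, Inl y) \<in> parcs (split_graph G r) \<longleftrightarrow> (x, y) \<in> remove_vertex (arcs_ends G) r"
    and "(Inl x, Inr C) \<in> parcs (split_graph G r) \<longleftrightarrow> C \<in> Cs \<and> x \<in> C \<and> (x, r) \<in> arcs_ends G"
    and "(Inr C, Inl x) \<in> parcs (split_graph G r) \<longleftrightarrow> C \<in> Cs \<and> x \<in> C \<and> (r, x) \<in> arcs_ends G"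
    and "(Inr C, Inr D) \<notin> parcs (split_graph G r)"
proof -
  have parcs: "parcs (split_graph G r) =
      (\<Union>C\<in>Cs. map_prod (split_label r C) (split_label r C) ` (arcs_ends G \<inter> (C \<union> {r}) \<times> (C \<union> {r})))"
    using assms(2) by (simp add: split_graph_def relabel_def Cs_def arcs_ends_induce)
  have label: "Inl x = split_label r C y \<longleftrightarrow> x = y \<and> y \<noteq> r" "Inr D = split_label r C y \<longleftrightarrow> D = C \<and> y = r" for x y C D
    by (auto simp: split_label_def)
  have C: "x \<noteq> r" if "C \<in> Cs" "x \<in> C" for C x
    using mem_components_del_vert(2)[OF assms(1)] that by (auto simp: Cs_def)
  have irrefl: "(r, r) \<notin> arcs_ends G" using graph_edges(4)[OF assms(1)] .
  show "(Inl x, Inl y) \<in> parcs (split_graph G r) \<longleftrightarrow> (x, y) \<in> remove_vertex (arcs_ends G) r"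
  proof
    assume "(Inl x, Inl y) \<in> parcs (split_graph G r)"
    then show "(x, y) \<in> remove_vertex (arcs_ends G) r"
      unfolding parcs by (auto simp: label remove_vertex_def)
  next
    assume xy: "(x, y) \<in> remove_vertex (arcs_ends G) r"
    then have "x \<in> verts G - {r}" using graph_edges(2)[OF assms(1)] by (auto simp: remove_vertex_def)
    then have "{z. (x, z) \<in> (remove_vertex (arcs_ends G) r)\<^sup>*} \<in> Cs"
      unfolding Cs_def components_eq[OF graph_del_vert(1)[OF assms(1)]] pre_digraph.del_vert_simps arcs_ends_del_vert
      by blast
    moreover have "x \<in> {z. (x, z) \<in> (remove_vertex (arcs_ends G) r)\<^sup>*}"
      "y \<in> {z. (x, z) \<in> (remove_vertex (arcs_ends G) r)\<^sup>*}" using xy by auto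
    ultimately obtain C where C: "C \<in> Cs" "x \<in> C" "y \<in> C" by blast
    moreover have "(x, y) \<in> arcs_ends G" "x \<noteq> r" "y \<noteq> r" using xy by (auto simp: remove_vertex_def)
    ultimately show "(Inl x, Inl y) \<in> parcs (split_graph G r)"
      unfolding parcs by (intro UN_I[of C] image_eqI[of _ _ "(x, y)"]) (auto simp: label)
  qed
  show "(Inl x, Inr C) \<in> parcs (split_graph G r) \<longleftrightarrow> C \<in> Cs \<and> x \<in> C \<and> (x, r) \<in> arcs_ends G"
  proof
    assume "(Inl x, Inr C) \<in> parcs (split_graph G r)"
    then show "C \<in> Cs \<and> x \<in> C \<and> (x, r) \<in> arcs_ends G" unfolding parcs using C irrefl by (auto simp: label)
  next
    assume "C \<in> Cs \<and> x \<in> C \<and> (x, r) \<in> arcs_ends G"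
    then show "(Inl x, Inr C) \<in> parcs (split_graph G r)"
      unfolding parcs using C[of C x] by (intro UN_I[of C] image_eqI[of _ _ "(x, r)"]) (auto simp: label)
  qed
  show "(Inr C, Inl x) \<in> parcs (split_graph G r) \<longleftrightarrow> C \<in> Cs \<and> x \<in> C \<and> (r, x) \<in> arcs_ends G"
  proof
    assume "(Inr C, Inl x) \<in> parcs (split_graph G r)"
    then show "C \<in> Cs \<and> x \<in> C \<and> (r, x) \<in> arcs_ends G" unfolding parcs using C irrefl by (auto simp: label)
  next
    assume "C \<in> Cs \<and> x \<in> C \<and> (r, x) \<in> arcs_ends G"
    then show "(Inr C, Inl x) \<in> parcs (split_graph G r)"
      unfolding parcs using C[of C x] by (intro UN_I[of C] image_eqI[of _ _ "(r, x)"]) (auto simp: label)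
  qed
  show "(Inr C, Inr D) \<notin> parcs (split_graph G r)"
    unfolding parcs using irrefl by (auto simp: label)
qed


lemma rtrancl_last_before:
  "(x, r) \<in> E\<^sup>* \<Longrightarrow> x \<noteq> r \<Longrightarrow> \<exists>z. (x, z) \<in> (remove_vertex E r)\<^sup>* \<and> (z, r) \<in> E"
proof (induction rule: converse_rtrancl_induct)
  case (step x y)
  show ?case
  proof (cases "y = r")
    case False
    then obtain z where "(y, z) \<in> (remove_vertex E r)\<^sup>*" "(z, r) \<in> E" using step.IH by blast
    moreover have "(x, y) \<in> remove_vertex E r" using step False by (simp add: remove_vertex_def)
    ultimately show ?thesis by (meson converse_rtrancl_into_rtrancl)
  qed (use step in blast)
qed simp

lemma graph_split_graph:
  assumes G: "graph G" and r: "r \<in> verts G" "verts G \<noteq> {r}"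
  shows "graph (with_proj (split_graph G r))"
proof -
  let ?Cs = "components (pre_digraph.del_vert G r)" and ?F = "split_graph G r"
  note edges = split_graph_edges[OF G r(2)] and pverts = split_graph_verts[OF G r]
  have finC: "finite ?Cs"
    unfolding components_eq[OF graph_del_vert(1)[OF G]] using graph_edges(1)[OF graph_del_vert(1)[OF G]] by simp
  have E: "arcs_ends G \<subseteq> verts G \<times> verts G" "sym (arcs_ends G)" using graph_edges[OF G] by auto
  have sub: "x \<in> verts G - {r}" if "C \<in> ?Cs" "x \<in> C" for x C
    using mem_components_del_vert(2)[OF G that] .
  have "\<alpha> \<in> pverts ?F \<and> \<beta> \<in> pverts ?F \<and> (\<beta>, \<alpha>) \<in> parcs ?F \<and> \<alpha> \<noteq> \<beta>" if "(\<alpha>, \<beta>) \<in> parcs ?F" for \<alpha> \<beta>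
    using that E sub graph_edges(4)[OF G]
    by (cases \<alpha>; cases \<beta>) (auto simp: edges pverts remove_vertex_def sym_def)
  then have "parcs ?F \<subseteq> pverts ?F \<times> pverts ?F" "sym (parcs ?F)" "\<And>\<alpha>. (\<alpha>, \<alpha>) \<notin> parcs ?F"
    by (auto intro: symI)
  moreover have "finite (pverts ?F)"
    unfolding pverts using finC graph_edges(1)[OF G] by (intro finite_Plus) auto
  ultimately show ?thesis by (intro graph_with_proj)
qed

lemma transversal_split_graph:
  assumes G: "graph G" "Digraph_Component.connected G" and r: "r \<in> verts G" "verts G \<noteq> {r}"
  shows "transversal (with_proj (split_graph G r)) (split_copies G r)"
proof -
  let ?Cs = "components (pre_digraph.del_vert G r)" and ?F = "parcs (split_graph G r)"
  define E where "E = remove_vertex (arcs_ends G) r"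
  note edges = split_graph_edges[OF G(1) r(2)] and pverts = split_graph_verts[OF G(1) r]
  note mem = mem_components_del_vert[OF G(1), of _ r, folded E_def]
  \<comment> \<open>The component of the graph without \<open>r\<close> to which a vertex of the
    split graph belongs. It is constant along edges, so at most one copy of \<open>r\<close> is
    reachable.\<close>
  define \<kappa> where "\<kappa> = case_sum (\<lambda>x. {y. (x, y) \<in> E\<^sup>*}) (\<lambda>C. C)"
  have copies: "split_copies G r = Inr ` ?Cs" using r(2) by (simp add: split_copies_def)
  have sym: "sym E" unfolding E_def using sym_remove_vertex[OF graph_edges(3)[OF G(1)]] .
  have step: "\<kappa> \<alpha> = \<kappa> \<beta>" if edge: "(\<alpha>, \<beta>) \<in> ?F" for \<alpha> \<beta>
  proof (cases \<alpha>)
    case \<alpha>: (Inl x)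
    show ?thesis
    proof (cases \<beta>)
      case (Inl y)
      then have "(x, y) \<in> E" using that \<alpha> edges(1) by (simp add: E_def)
      then have "(x, z) \<in> E\<^sup>* \<longleftrightarrow> (y, z) \<in> E\<^sup>*" for z
        using sym by (meson converse_rtrancl_into_rtrancl symD)
      then show ?thesis by (simp add: \<alpha> Inl \<kappa>_def)
    next
      case (Inr C)
      then have "C \<in> ?Cs" "x \<in> C" using that \<alpha> edges(2) by auto
      then show ?thesis using mem(1) by (simp add: \<alpha> Inr \<kappa>_def)
    qed
  next
    case \<alpha>: (Inr C)
    with edge edges(4) obtain y where \<beta>: "\<beta> = Inl y" by (cases \<beta>) auto
    then have "C \<in> ?Cs" "y \<in> C" using that \<alpha> edges(3) by auto
    then show ?thesis using mem(1) by (simp add: \<alpha> \<beta> \<kappa>_def)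
  qed
  have \<kappa>: "\<kappa> \<alpha> = \<kappa> \<beta>" if "(\<alpha>, \<beta>) \<in> ?F\<^sup>*" for \<alpha> \<beta>
    using that by (induction rule: rtrancl_induct) (auto dest: step)
  have ex: "(\<alpha>, Inr (\<kappa> \<alpha>)) \<in> ?F\<^sup>* \<and> \<kappa> \<alpha> \<in> ?Cs" if "\<alpha> \<in> pverts (split_graph G r)" for \<alpha>
  proof (cases \<alpha>)
    case (Inl x)
    then have x: "x \<in> verts G" "x \<noteq> r" using that pverts by auto
    then have C: "\<kappa> \<alpha> \<in> ?Cs"
      unfolding components_eq[OF graph_del_vert(1)[OF G(1)]] pre_digraph.del_vert_simps arcs_ends_del_vert
      by (auto simp: Inl \<kappa>_def E_def)
    have "(x, r) \<in> (arcs_ends G)\<^sup>*" using G r(1) x(1) by (auto simp: connected_iff)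
    \<comment> \<open>The vertex \<open>z\<close> through which a walk first enters \<open>r\<close>
      joins the component of \<open>x\<close> to its copy of \<open>r\<close>.\<close>
    from rtrancl_last_before[OF this x(2), folded E_def]
    obtain z where z: "(x, z) \<in> E\<^sup>*" "(z, r) \<in> arcs_ends G" by blast
    from z(1) have "(Inl x, Inl z) \<in> ?F\<^sup>*"
    proof induction
      case (step y z)
      then show ?case using edges(1)[of y z] by (auto simp: E_def intro: rtrancl.rtrancl_into_rtrancl)
    qed simp
    moreover have "(Inl z, Inr (\<kappa> \<alpha>)) \<in> ?F" using edges(2) C z by (simp add: Inl \<kappa>_def)
    ultimately show ?thesis using C Inl by (auto intro: rtrancl.rtrancl_into_rtrancl)
  next
    case (Inr C)
    then show ?thesis using that pverts by (auto simp: \<kappa>_def)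
  qed
  have "\<exists>!\<rho>. \<rho> \<in> Inr ` ?Cs \<and> (\<alpha>, \<rho>) \<in> ?F\<^sup>*" if "\<alpha> \<in> pverts (split_graph G r)" for \<alpha>
  proof (rule ex1I[of _ "Inr (\<kappa> \<alpha>)"])
    show "Inr (\<kappa> \<alpha>) \<in> Inr ` ?Cs \<and> (\<alpha>, Inr (\<kappa> \<alpha>)) \<in> ?F\<^sup>*" using ex[OF that] by blast
    fix \<rho> assume "\<rho> \<in> Inr ` ?Cs \<and> (\<alpha>, \<rho>) \<in> ?F\<^sup>*"
    then obtain C where C: "\<rho> = Inr C" "(\<alpha>, Inr C) \<in> ?F\<^sup>*" by blast
    have "\<kappa> (Inr C) = C" by (simp add: \<kappa>_def)
    with \<kappa>[OF C(2)] C(1) show "\<rho> = Inr (\<kappa> \<alpha>)" by (simp only:)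
  qed
  then show ?thesis
    unfolding transversal_def copies with_proj_simps by (intro conjI ballI) (auto simp: pverts)
qed

context magic_graph
begin

lemma projection_col_sum:
  assumes "D \<subseteq> I" "x \<in> J" shows "projection (\<Sum>b\<in>D. U b x)"
proof -
  have fin: "finite D" using assms(1) finite_rows finite_subset by blast
  have "(\<Sum>b\<in>D. U b x) * (\<Sum>b\<in>D. U b x) = (\<Sum>b\<in>D. \<Sum>c\<in>D. U b x * U c x)"
    by (rule sum_product)
  also have "\<dots> = (\<Sum>b\<in>D. \<Sum>c\<in>D. if b = c then U b x else 0)"
    using assms col_orthogonal entry_idem by (intro sum.cong refl) (auto simp: subset_iff)
  also have "\<dots> = (\<Sum>b\<in>D. U b x)" using fin by simp
  finally show ?thesis
    using assms projection_entry by (auto simp: projection_def star_sum intro!: sum.cong)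
qed

text \<open>
  The common value is the entry of the matrix \<open>P\<close> at the two components: the product of the two
  sums equals either factor, as entries linking \<open>C\<close> to the complement of \<open>D\<close> are orthogonal to
  those linking \<open>C\<close> to \<open>D\<close>.
\<close>

lemma component_sum_eq:
  assumes x: "x \<in> J" and b: "b \<in> I"
  defines "C \<equiv> {y. (x, y) \<in> E\<^sup>*}" and "D \<equiv> {c. (b, c) \<in> F\<^sup>*}"
  assumes sym: "sym F"
  shows "(\<Sum>c\<in>D. U c x) = (\<Sum>y\<in>C. U b y)"
proof -
  have C: "C \<subseteq> J" using rtrancl_in[OF _ E] x by (auto simp: C_def)
  have D: "D \<subseteq> I" using rtrancl_in[OF _ F] b by (auto simp: D_def)
  have orth: "U c x * U b y = 0" if "c \<in> I" "y \<in> J" "(y \<in> C) \<noteq> (c \<in> D)" for c y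
  proof (rule ccontr)
    assume "U c x * U b y \<noteq> 0"
    from compatD[OF compat_reachable that(1) b x that(2) this] that(3) sym_rtranclD[OF sym]
    show False unfolding C_def D_def by blast
  qed
  have "(\<Sum>c\<in>D. U c x) * (\<Sum>y\<in>C. U b y) = (\<Sum>c\<in>D. U c x) * (\<Sum>y\<in>J. U b y)"
    unfolding sum_product using C D orth finite_cols
    by (intro sum.cong refl sum.mono_neutral_left) auto
  moreover have "(\<Sum>c\<in>D. U c x) * (\<Sum>y\<in>C. U b y) = (\<Sum>c\<in>I. U c x) * (\<Sum>y\<in>C. U b y)"
    unfolding sum_product using C D orth finite_rows
    by (intro sum.mono_neutral_left) (auto intro!: sum.neutral)
  ultimately show ?thesis using sum_row[OF b] sum_col[OF x] by simp
qed

end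

text \<open>Apart from the edges avoiding the cut vertices there are only those between a vertex
  \<open>x\<close> and a copy \<open>Inr C\<close>. They say that \<open>x\<close> lies in
  \<open>C\<close>, which is reachability without \<open>r\<close> and respected by the restriction
  of \<open>U\<close>, and that \<open>x\<close> is adjacent to \<open>r\<close>, which is respected
  since \<open>U s r = 1\<close>.\<close>

lemma quantum_iso_split_graph:
  fixes U :: "'b \<Rightarrow> 'a \<Rightarrow> 'x::unital_cstar_algebra"
  assumes iso: "quantum_iso G H U" and r: "r \<in> verts G" "verts G \<noteq> {r}" and s: "s \<in> verts H" "verts H \<noteq> {s}"
    and RS: "\<And>a x. a \<in> verts H \<Longrightarrow> x \<in> verts G \<Longrightarrow> U a x \<noteq> 0 \<Longrightarrow> x = r \<longleftrightarrow> a = s"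
    and w: "\<And>C. C \<in> components (pre_digraph.del_vert G r) \<Longrightarrow> w C \<in> C"
  shows "quantum_iso (with_proj (split_graph G r)) (with_proj (split_graph H s)) (Gamma_matrix w U)"
proof -
  have G: "graph G" and H: "graph H" using iso by (auto simp: quantum_iso_iff)
  interpret magic_graph "verts H" "verts G" U "arcs_ends G" "arcs_ends H" using magic_graphI[OF iso] .
  let ?J = "verts G - {r}" and ?I = "verts H - {s}"
  define E F where "E = remove_vertex (arcs_ends G) r" and "F = remove_vertex (arcs_ends H) s"
  define Cs Ds where "Cs = components (pre_digraph.del_vert G r)" and "Ds = components (pre_digraph.del_vert H s)"
  have EF: "E \<subseteq> ?J \<times> ?J" "F \<subseteq> ?I \<times> ?I" "sym E" "sym F"
    using graph_edges(2,3)[OF G] graph_edges(2,3)[OF H]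
    by (auto simp: E_def F_def sym_remove_vertex) (auto simp: remove_vertex_def)
  have zero: "U a r = 0" if "a \<in> ?I" for a
    using RS[of a r] that r by auto
  have zero': "U s x = 0" if "x \<in> ?J" for x
    using RS[of s x] that s by auto
  have one: "U s r = 1"
    using sum_col[OF r(1)] zero finite_rows s(1) by (simp add: sum.remove[of "verts H" s])
  \<comment> \<open>Row \<open>s\<close> and column \<open>r\<close> vanish outside their common
    entry, so deleting them preserves the row and column sums.\<close>
  have "magic_unitary ?I ?J U"
    unfolding magic_unitary_def
  proof (intro conjI ballI)
    show "(\<Sum>k\<in>?I. U k j) = 1" if "j \<in> ?J" for j
      using sum_col[of j] that zero' finite_rows s(1) by (simp add: sum.remove[of "verts H" s])
    show "(\<Sum>k\<in>?J. U i k) = 1" if "i \<in> ?I" for i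
      using sum_row[of i] that zero finite_cols r(1) by (simp add: sum.remove[of "verts G" r])
  qed (use magic_unitary in \<open>auto simp: magic_unitary_def\<close>)
  then interpret U0: magic_graph ?I ?J U E F
    using EF compat_edge by unfold_locales (auto simp: compat_def magic.compat_def magic_def E_def F_def remove_vertex_def)
  have C: "C = {y. (x, y) \<in> E\<^sup>*}" "x \<in> ?J" if "C \<in> Cs" "x \<in> C" for C x
    using mem_components_del_vert[OF G, of C r x] that by (auto simp: Cs_def E_def)
  have D: "D = {c. (b, c) \<in> F\<^sup>*}" "b \<in> ?I" if "D \<in> Ds" "b \<in> D" for D b
    using mem_components_del_vert[OF H, of D s b] that by (auto simp: Ds_def F_def)
  have Cs: "Cs = (\<lambda>x. {y. (x, y) \<in> E\<^sup>*}) ` ?J"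
    unfolding Cs_def components_eq[OF graph_del_vert(1)[OF G]] pre_digraph.del_vert_simps arcs_ends_del_vert E_def ..
  have Ds: "Ds = (\<lambda>x. {y. (x, y) \<in> F\<^sup>*}) ` ?I"
    unfolding Ds_def components_eq[OF graph_del_vert(1)[OF H]] pre_digraph.del_vert_simps arcs_ends_del_vert F_def ..
  have fin: "finite Cs" "finite Ds" unfolding Cs Ds using finite_rows finite_cols by auto
  have Union: "\<Union>Cs = ?J" "\<Union>Ds = ?I" using C(2) D(2) Cs Ds by blast+
  have "C = C'" if "C \<in> Cs" "C' \<in> Cs" "C \<inter> C' \<noteq> {}" for C C'
    using C(1)[OF that(1)] C(1)[OF that(2)] that(3) by blast
  then have sumC: "(\<Sum>C\<in>Cs. \<Sum>x\<in>C. f x) = (\<Sum>x\<in>?J. f x)" for f :: "'a \<Rightarrow> 'x"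
    unfolding Union(1)[symmetric] using C(2) finite_cols
    by (subst sum.Union_disjoint) (auto intro: finite_subset[of _ "verts G"])
  have "D = D'" if "D \<in> Ds" "D' \<in> Ds" "D \<inter> D' \<noteq> {}" for D D'
    using D(1)[OF that(1)] D(1)[OF that(2)] that(3) by blast
  then have sumD: "(\<Sum>D\<in>Ds. \<Sum>b\<in>D. f b) = (\<Sum>b\<in>?I. f b)" for f :: "'b \<Rightarrow> 'x"
    unfolding Union(2)[symmetric] using D(2) finite_rows
    by (subst sum.Union_disjoint) (auto intro: finite_subset[of _ "verts H"])
  have wC: "w C \<in> C" "w C \<in> ?J" if "C \<in> Cs" for C
    using w that C(2) by (auto simp: Cs_def)
  \<comment> \<open>This turns a sum in the column \<open>w C\<close> into a sum along the row
    \<open>b\<close>. The columns of the new matrix sum to 1 directly; the rows do so by this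
    exchange.\<close>
  have p: "(\<Sum>c\<in>D. U c (w C)) = (\<Sum>y\<in>C. U b y)" if "C \<in> Cs" "D \<in> Ds" "b \<in> D" for C D b
    using U0.component_sum_eq[OF wC(2)[OF that(1)] D(2)[OF that(2,3)] EF(4)]
    by (simp only: C(1)[OF that(1) wC(1)[OF that(1)], symmetric] D(1)[OF that(2,3), symmetric])
  let ?V = "Gamma_matrix w U"
  have magic: "magic_unitary (?I <+> Ds) (?J <+> Cs) ?V"
    unfolding magic_unitary_def
  proof (intro conjI ballI)
    show "finite (?I <+> Ds)" "finite (?J <+> Cs)" using fin finite_rows finite_cols by auto
    fix \<alpha> \<xi> assume \<alpha>: "\<alpha> \<in> ?I <+> Ds" and \<xi>: "\<xi> \<in> ?J <+> Cs"
    have "projection (\<Sum>b\<in>D. U b (w C))" if "D \<in> Ds" "C \<in> Cs" for D C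
      using D(2)[OF that(1)] wC(2)[OF that(2)] by (intro U0.projection_col_sum) auto
    moreover have "projection (0::'x)" by (simp add: projection_def star_zero)
    ultimately have "projection (?V \<alpha> \<xi>)"
      using \<alpha> \<xi> U0.projection_entry by (cases \<alpha>; cases \<xi>) auto
    then show "?V \<alpha> \<xi> = (?V \<alpha> \<xi>)\<^sup>2" "?V \<alpha> \<xi> = star (?V \<alpha> \<xi>)"
      by (simp_all add: projection_def power2_eq_square)
  next
    fix \<xi> assume "\<xi> \<in> ?J <+> Cs"
    then show "(\<Sum>\<alpha>\<in>?I <+> Ds. ?V \<alpha> \<xi>) = 1"
      using fin finite_rows U0.sum_col wC(2) by (cases \<xi>) (auto simp: sum.Plus sumD)
  next
    fix \<alpha> assume \<alpha>: "\<alpha> \<in> ?I <+> Ds"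
    show "(\<Sum>\<xi>\<in>?J <+> Cs. ?V \<alpha> \<xi>) = 1"
    proof (cases \<alpha>)
      case (Inl a)
      then show ?thesis using \<alpha> fin finite_cols U0.sum_row by (auto simp: sum.Plus)
    next
      case (Inr D)
      then have "D \<in> Ds" using \<alpha> by auto
      then obtain b where b: "b \<in> D" unfolding Ds by blast
      then have "b \<in> ?I" using D(2) \<open>D \<in> Ds\<close> by blast
      have "(\<Sum>\<xi>\<in>?J <+> Cs. ?V \<alpha> \<xi>) = (\<Sum>C\<in>Cs. \<Sum>y\<in>C. U b y)"
        using fin finite_cols p[OF _ \<open>D \<in> Ds\<close> b] by (simp add: sum.Plus Inr)
      then show ?thesis using sumC U0.sum_row[OF \<open>b \<in> ?I\<close>] by simp
    qed
  qed
  interpret V: magic "?I <+> Ds" "?J <+> Cs" ?V using magic by unfold_locales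
  have attached: "x \<in> C \<longleftrightarrow> a \<in> D"
    if "C \<in> Cs" "D \<in> Ds" "x \<in> ?J" "a \<in> ?I" "U a x * ?V (Inr D) (Inr C) \<noteq> 0" for C D x a
  proof -
    \<comment> \<open>Some summand already gives a nonzero product; it links \<open>(x, w C)\<close>
      to \<open>(a, b)\<close>, and reachability decides membership in \<open>C\<close> and
      \<open>D\<close>.\<close>
    have "U a x * ?V (Inr D) (Inr C) = (\<Sum>b\<in>D. U a x * U b (w C))" by (simp add: sum_distrib_left)
    with that(5) have "\<not> (\<forall>b\<in>D. U a x * U b (w C) = 0)" by (metis (no_types, lifting) sum.neutral)
    then obtain b where b: "b \<in> D" "U a x * U b (w C) \<noteq> 0" by blast
    have "x \<in> C \<longleftrightarrow> (x, w C) \<in> E\<^sup>*"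
      using C(1)[OF that(1) wC(1)[OF that(1)]] sym_rtranclD[OF EF(3)] by blast
    also have "\<dots> \<longleftrightarrow> (a, b) \<in> F\<^sup>*"
      using U0.compatD[OF U0.compat_reachable that(4) D(2)[OF that(2) b(1)] that(3) wC(2)[OF that(1)] b(2)] .
    also have "\<dots> \<longleftrightarrow> a \<in> D"
      using D(1)[OF that(2) b(1)] sym_rtranclD[OF EF(4)] by blast
    finally show ?thesis .
  qed
  have hub: "(x, r) \<in> arcs_ends G \<longleftrightarrow> (a, s) \<in> arcs_ends H" if "x \<in> ?J" "a \<in> ?I" "U a x \<noteq> 0" for x a
    using compatD[OF compat_edge, of a s x r] that r s one by simp
  have symGH: "(r, x) \<in> arcs_ends G \<longleftrightarrow> (x, r) \<in> arcs_ends G" "(s, a) \<in> arcs_ends H \<longleftrightarrow> (a, s) \<in> arcs_ends H" for x a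
    using graph_edges(3)[OF G] graph_edges(3)[OF H] by (auto dest: symD)
  note edges = split_graph_edges[OF G r(2), folded E_def Cs_def] split_graph_edges[OF H s(2), folded F_def Ds_def]
  have mixed: "(Inl x, Inr C) \<in> parcs (split_graph G r) \<longleftrightarrow> (Inl a, Inr D) \<in> parcs (split_graph H s)"
    "(Inr C, Inl x) \<in> parcs (split_graph G r) \<longleftrightarrow> (Inr D, Inl a) \<in> parcs (split_graph H s)"
    if "C \<in> Cs" "D \<in> Ds" "x \<in> ?J" "a \<in> ?I" "U a x * ?V (Inr D) (Inr C) \<noteq> 0" for C D x a
  proof -
    have "U a x \<noteq> 0" using that(5) by auto
    then show "(Inl x, Inr C) \<in> parcs (split_graph G r) \<longleftrightarrow> (Inl a, Inr D) \<in> parcs (split_graph H s)"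
      "(Inr C, Inl x) \<in> parcs (split_graph G r) \<longleftrightarrow> (Inr D, Inl a) \<in> parcs (split_graph H s)"
      unfolding edges symGH using attached[OF that] hub[OF that(3,4)] that(1,2) by blast+
  qed
  have "V.compat (\<lambda>\<xi> \<eta>. (\<xi>, \<eta>) \<in> parcs (split_graph G r)) (\<lambda>\<alpha> \<beta>. (\<alpha>, \<beta>) \<in> parcs (split_graph H s))"
    unfolding V.compat_def
  proof (intro ballI impI)
    fix \<alpha> \<beta> \<xi> \<eta>
    assume in_verts: "\<alpha> \<in> ?I <+> Ds" "\<beta> \<in> ?I <+> Ds" "\<xi> \<in> ?J <+> Cs" "\<eta> \<in> ?J <+> Cs"
      and ne: "?V \<alpha> \<xi> * ?V \<beta> \<eta> \<noteq> 0"
    then have "?V \<alpha> \<xi> \<noteq> 0" "?V \<beta> \<eta> \<noteq> 0" by auto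
    \<comment> \<open>Entries between an original vertex and a copy are 0, so row and column labels
      are of the same kind.\<close>
    then consider (ll) a x b y where "\<alpha> = Inl a" "\<xi> = Inl x" "\<beta> = Inl b" "\<eta> = Inl y"
      | (lr) a x D C where "\<alpha> = Inl a" "\<xi> = Inl x" "\<beta> = Inr D" "\<eta> = Inr C"
      | (rl) D C b y where "\<alpha> = Inr D" "\<xi> = Inr C" "\<beta> = Inl b" "\<eta> = Inl y"
      | (rr) D C D' C' where "\<alpha> = Inr D" "\<xi> = Inr C" "\<beta> = Inr D'" "\<eta> = Inr C'"
      by (cases \<alpha>; cases \<beta>; cases \<xi>; cases \<eta>) auto
    then show "((\<xi>, \<eta>) \<in> parcs (split_graph G r)) = ((\<alpha>, \<beta>) \<in> parcs (split_graph H s))"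
    proof cases
      case ll
      then show ?thesis
        using in_verts ne U0.compatD[OF U0.compat_edge, of a b x y] by (auto simp: edges)
    next
      case lr
      then have "x \<in> ?J" "a \<in> ?I" "C \<in> Cs" "D \<in> Ds" using in_verts by auto
      then show ?thesis using ne lr mixed(1)[of C D x a] by simp
    next
      case rl
      then have "y \<in> ?J" "b \<in> ?I" "C \<in> Cs" "D \<in> Ds" using in_verts by auto
      \<comment> \<open>Here the copy comes first in the product; taking adjoints swaps the
        factors.\<close>
      moreover have "U b y * ?V (Inr D) (Inr C) \<noteq> 0"
        using ne rl mult_projections_eq_0_commute[OF V.projection_entry V.projection_entry, OF in_verts(2,4,1,3)]
        by auto
      ultimately show ?thesis using mixed(2)[of C D y b] rl by simp
    next
      case rr
      then show ?thesis by (simp add: edges)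
    qed
  qed
  then show ?thesis
    unfolding quantum_iso_iff with_proj_simps split_graph_verts[OF G r] split_graph_verts[OF H s]
      Cs_def[symmetric] Ds_def[symmetric]
    using magic graph_split_graph[OF G r] graph_split_graph[OF H s] by (intro conjI)
qed

section \<open>Combination of the two kinds of anchors\<close>

lemma block_not_singleton:
  assumes "graph G" "is_block G {r}" shows False
  using assms(2) unfolding is_block_iff[OF assms(1)] maximal_inseparable_def by blast

theorem theorem4p12:
  fixes G :: "('a, 'e) pre_digraph" and H :: "('b, 'f) pre_digraph"
    and U :: "'b \<Rightarrow> 'a \<Rightarrow> 'x::unital_cstar_algebra"
    and w :: "'a set \<Rightarrow> 'a"
  assumes "connected_anchored_graph G R"
    and "connected_anchored_graph H S"
    and "anchored_quantum_iso (G, R) (H, S) U"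
    and "\<And>r C. R = {r} \<Longrightarrow> C \<in> components (pre_digraph.del_vert G r) \<Longrightarrow> w C \<in> C"
  shows "anchored_quantum_iso (Gamma_graph G R) (Gamma_graph H S) (Gamma_matrix w U)"
proof -
  have iso: "quantum_iso G H U" and R: "R \<subseteq> verts G" and S: "S \<subseteq> verts H"
    and RS: "\<And>a x. a \<in> verts H \<Longrightarrow> x \<in> verts G \<Longrightarrow> U a x \<noteq> 0 \<Longrightarrow> x \<in> R \<longleftrightarrow> a \<in> S"
    using assms(3) by (auto simp: anchored_quantum_iso_def anchored_graph_def)
  have G: "graph G" "Digraph_Component.connected G" and H: "graph H" "Digraph_Component.connected H"
    using assms(1,2) by (auto simp: connected_anchored_graph_def)
  interpret magic_graph "verts H" "verts G" U "arcs_ends G" "arcs_ends H" using magic_graphI[OF iso] .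
  \<comment> \<open>As no singleton is a block, equal cardinality forces both anchors to be of the
    same kind.\<close>
  have card: "card R = card S" using card_blocks_eq[OF R S RS] .
  show ?thesis
  proof (cases "\<exists>r. R = {r} \<and> cut_vertex G r")
    case True
    then obtain r where r: "R = {r}" "cut_vertex G r" by blast
    then obtain s where s: "S = {s}" using card by (metis card_1_singletonE card.empty card.insert
        empty_iff finite.emptyI One_nat_def)
    then have cut: "cut_vertex H s"
      using assms(2) block_not_singleton[OF H(1)] by (auto simp: connected_anchored_graph_def)
    have rG: "r \<in> verts G" and sH: "s \<in> verts H" using R S r s by auto
    have Gamma: "Gamma_graph G R = (with_proj (split_graph G r), \<Union>v\<in>split_copies G r. rho (with_proj (split_graph G r)) v)"
      "Gamma_graph H S = (with_proj (split_graph H s), \<Union>v\<in>split_copies H s. rho (with_proj (split_graph H s)) v)"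
      using r s cut by (simp_all add: Gamma_graph_def Let_def)
    show ?thesis
    proof (cases "verts G = {r}")
      case True
      then have vH: "verts H = {s}"
        using card_eq sH by (metis card_1_singletonE card.empty card.insert empty_iff finite.emptyI
            One_nat_def singletonD)
      \<comment> \<open>With a single vertex nothing is cut: splitting only relabels, and the vertex
        represents its component.\<close>
      have "transversal G {r}" "transversal H {s}" using True vH by (auto simp: transversal_def)
      note trans = this[THEN transversal_relabel[OF inj_Inl], unfolded image_insert image_empty]
      have split: "split_graph G r = relabel Inl G" "split_copies G r = {Inl r}"
        "split_graph H s = relabel Inl H" "split_copies H s = {Inl s}"
        using True vH by (simp_all add: split_graph_def split_copies_def)
      show ?thesis
        unfolding Gamma split
      proof (rule anchored_quantum_iso_rho[OF quantum_iso_relabel[OF iso] trans])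
        fix \<alpha> \<xi> assume "\<alpha> \<in> verts (with_proj (relabel Inl H))" "\<xi> \<in> verts (with_proj (relabel Inl G))"
        then show "\<xi> \<in> {Inl r} \<longleftrightarrow> \<alpha> \<in> {Inl s}" unfolding relabel_simps using True vH by simp
      qed
    next
      case False
      then have vH: "verts H \<noteq> {s}"
        using card_eq rG by (metis card_1_singletonE card.empty card.insert empty_iff finite.emptyI
            One_nat_def singletonD)
      show ?thesis
        unfolding Gamma
      proof (rule anchored_quantum_iso_rho)
        show "quantum_iso (with_proj (split_graph G r)) (with_proj (split_graph H s)) (Gamma_matrix w U)"
          using RS assms(4) r s by (intro quantum_iso_split_graph[OF iso rG False sH vH]) auto
        show "transversal (with_proj (split_graph G r)) (split_copies G r)"
          using transversal_split_graph[OF G rG False] .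
        show "transversal (with_proj (split_graph H s)) (split_copies H s)"
          using transversal_split_graph[OF H sH vH] .
        fix \<alpha> \<xi> assume "\<alpha> \<in> verts (with_proj (split_graph H s))" "\<xi> \<in> verts (with_proj (split_graph G r))"
          "Gamma_matrix w U \<alpha> \<xi> \<noteq> 0"
        then show "\<xi> \<in> split_copies G r \<longleftrightarrow> \<alpha> \<in> split_copies H s"
          using split_graph_verts[OF G(1) rG False] split_graph_verts[OF H(1) sH vH] False vH
          by (cases \<alpha>; cases \<xi>) (auto simp: split_copies_def)
      qed
    qed
  next
    case False
    then have block: "is_block G R" using assms(1) by (auto simp: connected_anchored_graph_def)
    have "\<nexists>s. S = {s}"
    proof
      assume "\<exists>s. S = {s}"
      then have "card R = 1" using card by auto
      then show False using block block_not_singleton[OF G(1)] by (metis card_1_singletonE)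
    qed
    then have block': "is_block H S" using assms(2) by (auto simp: connected_anchored_graph_def)
    have Gamma: "Gamma_graph G R = (with_proj (relabel Inl (del_edges_within G R)), Inl ` (\<Union>r\<in>R. rho (del_edges_within G R) r))"
      "Gamma_graph H S = (with_proj (relabel Inl (del_edges_within H S)), Inl ` (\<Union>s\<in>S. rho (del_edges_within H S) s))"
      using False \<open>\<nexists>s. S = {s}\<close> by (auto simp: Gamma_graph_def Let_def)
    show ?thesis
      unfolding Gamma
      by (rule anchored_quantum_iso_relabel[OF quantum_iso_del_edges_within[OF iso RS]
            transversal_del_edges_within[OF G block] transversal_del_edges_within[OF H block']])
        (auto simp: del_edges_within_simps dest: RS)
  qed
qed

end
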